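(* Let $V\in\mathbb{R}^{L\times n}$ have rows $V_1,\dots,V_L$, let $\mathbf{1}\in\mathbb{R}^L$ be the all-ones vector, and let the uncertainty set be the polytope $\mathbb{S}=\{\xi\in\mathbb{R}^n : V\xi\le \mathbf{1}\}$. Let $\hat\xi_1,\dots,\hat\xi_N\in\mathbb{S}$ be uncertainty samples with empirical distribution $\hat{\mathbb{P}}_N$, let $\epsilon>0$, and let $\mathbb{B}_\epsilon(\hat{\mathbb{P}}_N)$ be the Wasserstein ball of radius $\epsilon$ around $\hat{\mathbb{P}}_N$ in the space of probability distributions supported on $\mathbb{S}$. Let $\mathcal{X}\subset\mathbb{R}^p$ be the decision set and $f(x,\xi)\le 0$ the constraint, with $f:\mathcal{X}\times\mathbb{R}^n\to\mathbb{R}^q$. For $\alpha\in[0,1]$ and $v\in\mathbb{S}$ define the open and closed safety sets $$\hat{\mathbb{S}}(\alpha,v)=\{\xi\in\mathbb{R}^n : V\xi<\alpha\mathbf{1}+(1-\alpha)Vv\},\qquad \hat{\mathbb{S}}^{c}(\alpha,v)=\{\xi\in\mathbb{R}^n : V\xi\le\alpha\mathbf{1}+(1-\alpha)Vv\}.$$ (i) (Worst case.) Assume that for all $\alpha\in[0,1]$, $v\in\mathbb{S}$ and $l\le L$ the half-space $\{\xi : \langle V_l,\xi\rangle\ge[\alpha\mathbf{1}+(1-\alpha)Vv]_l\}$ has nonempty intersection with $\mathbb{S}$. Then the problem of minimizing the worst-case probability of being unsafe, $$\min_{x\in\mathcal{X},\,\alpha\in[0,1],\,v\in\mathbb{S}}\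 \sup_{\mathbb{Q}\in\mathbb{B}_\epsilon(\hat{\mathbb{P}}_N)}\mathbb{Q}\big(\xi\notin\hat{\mathbb{S}}(\alpha,v)\big)\quad\text{s.t. } f(x,\xi)\le 0\ \ \forall \xi\in\hat{\mathbb{S}}(\alpha,v),$$ is equivalent to $$\begin{aligned}\inf_{\alpha,x,v,\lambda,s_i,\gamma_{il},\theta_{il}}\quad&\lambda\epsilon+\frac1N\sum_{i=1}^N s_i\\ \text{s.t.}\quad& 1-\theta_{il}\big([\alpha\mathbf{1}+(1-\alpha)Vv]_l-\langle V_l,\hat\xi_i\rangle\big)+\langle\gamma_{il},\mathbf{1}-V\hat\xi_i\rangle\le s_i,\quad\forall i\le N,\ \forall l\le L,\\ &\|V_l^\top\theta_{il}-V^\top\gamma_{il}\|_*\le\lambda,\quad\forall i\le N,\ \forall l\le L,\\ &\gamma_{il}\ge0,\ \theta_{il}\ge0,\ s_i\ge0,\quad\forall i\le N,\ \forall l\le L,\\ &0\le\alpha\le1,\quad Vv\le\mathbf{1},\\ &f(x,\xi)\le0,\quad x\in\mathcal{X},\quad\forall\xi\in\hat{\mathbb{S}}(\alpha,v),\end{aligned}$$ where $\lambda,s_i,\theta_{il}\in\mathbb{R}$ and $\gamma_{il}\in\mathbb{R}^L$. (ii) (Best case.) Assume that for all $\alpha\in[0,1]$ and $v\in\mathbb{S}$ the set $\hat{\mathbb{S}}^{c}(\alpha,v)$ has nonempty intersection with $\mathbb{S}$. Then the problem of maximizing the best-case probability of being safe, $$\max_{x\in\mathcal{X},\,\alpha\in[0,1],\,v\in\mathbb{S}}\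 \sup_{\mathbb{Q}\in\mathbb{B}_\epsilon(\hat{\mathbb{P}}_N)}\mathbb{Q}\big(\xi\in\hat{\mathbb{S}}^{c}(\alpha,v)\big)\quad\text{s.t. } f(x,\xi)\le 0\ \ \forall \xi\in\hat{\mathbb{S}}^{c}(\alpha,v),$$ is equivalent to $$\begin{aligned}\max_{z,\alpha,x,v,\lambda,s_i,\gamma_i,\theta_i}\quad& z\\ \text{s.t.}\quad& z\le\lambda\epsilon+\frac1N\sum_{i=1}^N s_i,\\ &1+\langle\theta_i,\alpha\mathbf{1}+(1-\alpha)Vv-V\hat\xi_i\rangle+\langle\gamma_i,\mathbf{1}-V\hat\xi_i\rangle\le s_i,\quad\forall i\le N,\\ &\|V^\top\theta_i+V^\top\gamma_i\|_*\le\lambda,\quad\forall i\le N,\\ &\gamma_i\ge0,\ \theta_i\ge0,\ s_i\ge0,\quad\forall i\le N,\\ &0\le\alpha\le1,\quad Vv\le\mathbf{1},\\ &f(x,\xi)\le0,\quad x\in\mathcal{X},\quad\forall\xi\in\hat{\mathbb{S}}^{c}(\alpha,v),\end{aligned}$$ where $z,\lambda,s_i\in\mathbb{R}$ and $\theta_i,\gamma_i\in\mathbb{R}^L$.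
   Context: Vector inequalities are componentwise, $[w]_l$ denotes the $l$-th entry of a vector $w$, and rows $V_l$ are identified with vectors in $\mathbb{R}^n$ (so $V_l^\top\theta_{il}$ is the vector $V_l$ times the scalar $\theta_{il}$). Fix a norm $\|\cdot\|$ on $\mathbb{R}^n$; its dual norm is $\|z\|_*=\sup_{\|\xi\|\le1}\langle z,\xi\rangle$. The empirical distribution is $\hat{\mathbb{P}}_N=\frac1N\sum_{i=1}^N\delta_{\hat\xi_i}$. The Wasserstein distance $d_{\mathrm{Wass}}(\mathbb{Q}_1,\mathbb{Q}_2)$ is the minimum cost of transporting the mass of $\mathbb{Q}_1$ to $\mathbb{Q}_2$ with transport cost $\|\xi_1-\xi_2\|$, i.e. the infimum over couplings $\Pi$ of $\mathbb{Q}_1,\mathbb{Q}_2$ of $\int\|\xi_1-\xi_2\|\,d\Pi$. The Wasserstein ball is $\mathbb{B}_\epsilon(\hat{\mathbb{P}}_N)=\{\mathbb{Q}\in\mathcal{M}(\mathbb{S}) : d_{\mathrm{Wass}}(\mathbb{Q},\hat{\mathbb{P}}_N)\le\epsilon\}$, where $\mathcal{M}(\mathbb{S})$ is the space of probability distributions supported on $\mathbb{S}$ (with finite first moment). Two optimization problems are called equivalent when they have the same optimal value (supremum or infimum).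
   Formalization: In (ii), z must satisfy z ≤ λε + (1/N)Σs_i for all λ, s_i, γ_i, θ_i meeting the listed constraints, instead of maximizing over them jointly with z; as printed, large λ makes the maximum +∞ whenever some (x, α, v) is feasible, while the original value is at most 1. *)

theory Defs
  imports "HOL-Analysis.Analysis" "HOL-Probability.Probability"
begin

definition is_norm :: "('a::real_vector \<Rightarrow> real) \<Rightarrow> bool" where
  "is_norm nn \<longleftrightarrow>
     (\<forall>x. nn x = 0 \<longleftrightarrow> x = 0) \<and>
     (\<forall>x y. nn (x + y) \<le> nn x + nn y) \<and>
     (\<forall>c x. nn (c *\<^sub>R x) = \<bar>c\<bar> * nn x)"

definition dual_norm :: "('a::real_inner \<Rightarrow> real) \<Rightarrow> 'a \<Rightarrow> real" where
  "dual_norm nn z = (SUP \<xi>\<in>{\<xi>. nn \<xi> \<le> 1}. z \<bullet> \<xi>)"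


definition empirical :: "nat \<Rightarrow> (nat \<Rightarrow> 'a::topological_space) \<Rightarrow> 'a measure" where
  "empirical N \<xi>h = distr (uniform_count_measure {1..N}) borel \<xi>h"

lemma emeasure_empirical:
  assumes "N \<ge> 1" "A \<in> sets borel"
  shows "emeasure (empirical N \<xi>h) A = ennreal ((\<Sum>i=1..N. indicator A (\<xi>h i)) / real N)"
proof -
  have "emeasure (empirical N \<xi>h) A
      = emeasure (uniform_count_measure {1..N}) (\<xi>h -` A \<inter> {1..N})"
    unfolding empirical_def using assms
    by (subst emeasure_distr) (auto simp: space_uniform_count_measure measurable_def sets_uniform_count_measure)
  also have "\<dots> = ennreal (real (card (\<xi>h -` A \<inter> {1..N})) / real N)"
    by (subst emeasure_uniform_count_measure) auto
  also have "real (card (\<xi>h -` A \<inter> {1..N})) = (\<Sum>i=1..N. indicator A (\<xi>h i))"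
    by (simp add: indicator_def sum.If_cases vimage_def Int_commute)
  finally show ?thesis .
qed

definition prob_dists ::
  "('a::euclidean_space \<Rightarrow> real) \<Rightarrow> 'a set \<Rightarrow> 'a measure set" where
  "prob_dists nn S =
     {Q. prob_space Q \<and> sets Q = sets borel \<and> measure Q S = 1 \<and> integrable Q nn}"

definition couplings :: "'a measure \<Rightarrow> 'a measure \<Rightarrow> ('a \<times> 'a) measure set" where
  "couplings Q1 Q2 =
     {J. sets J = sets (Q1 \<Otimes>\<^sub>M Q2) \<and> distr J Q1 fst = Q1 \<and> distr J Q2 snd = Q2}"

definition wasserstein ::
  "('a::euclidean_space \<Rightarrow> real) \<Rightarrow> 'a measure \<Rightarrow> 'a measure \<Rightarrow> ennreal" where
  "wasserstein nn Q1 Q2 =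
     (INF J\<in>couplings Q1 Q2. \<integral>\<^sup>+ w. ennreal (nn (fst w - snd w)) \<partial>J)"

definition wasserstein_ball ::
  "('a::euclidean_space \<Rightarrow> real) \<Rightarrow> 'a set \<Rightarrow> real \<Rightarrow> 'a measure \<Rightarrow> 'a measure set" where
  "wasserstein_ball nn S \<epsilon> P = {Q \<in> prob_dists nn S. wasserstein nn Q P \<le> ennreal \<epsilon>}"


text \<open>On \<open>real ^ 'l\<close>, \<open>1\<close> is the all-ones vector and \<open>\<le>\<close> is componentwise,
  but \<open><\<close> is not the componentwise strict order, so the open set spells it out.\<close>

definition uncertainty_set :: "real ^ 'n ^ 'l \<Rightarrow> (real ^ 'n) set" where
  "uncertainty_set V = {\<xi>. V *v \<xi> \<le> 1}"

definition safety_bound :: "real ^ 'n ^ 'l \<Rightarrow> real \<Rightarrow> real ^ 'n \<Rightarrow> real ^ 'l" where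
  "safety_bound V \<alpha> v = \<alpha> *\<^sub>R 1 + (1 - \<alpha>) *\<^sub>R (V *v v)"

definition safe_open :: "real ^ 'n ^ 'l \<Rightarrow> real \<Rightarrow> real ^ 'n \<Rightarrow> (real ^ 'n) set" where
  "safe_open V \<alpha> v = {\<xi>. \<forall>l. (V *v \<xi>) $ l < safety_bound V \<alpha> v $ l}"

definition safe_closed :: "real ^ 'n ^ 'l \<Rightarrow> real \<Rightarrow> real ^ 'n \<Rightarrow> (real ^ 'n) set" where
  "safe_closed V \<alpha> v = {\<xi>. V *v \<xi> \<le> safety_bound V \<alpha> v}"


definition worst_case_multipliers ::
  "(real ^ 'n \<Rightarrow> real) \<Rightarrow> real ^ 'n ^ 'l \<Rightarrow> nat \<Rightarrow> (nat \<Rightarrow> real ^ 'n) \<Rightarrow> real \<Rightarrow> real ^ 'n \<Rightarrow>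
   real \<Rightarrow> (nat \<Rightarrow> real) \<Rightarrow> (nat \<Rightarrow> 'l \<Rightarrow> real ^ 'l) \<Rightarrow> (nat \<Rightarrow> 'l \<Rightarrow> real) \<Rightarrow> bool" where
  "worst_case_multipliers nn V N \<xi>h \<alpha> v lam s \<gamma> \<theta> \<longleftrightarrow>
     (\<forall>i\<in>{1..N}. \<forall>l.
        1 - \<theta> i l * (safety_bound V \<alpha> v $ l - (V $ l) \<bullet> \<xi>h i) + \<gamma> i l \<bullet> (1 - V *v \<xi>h i) \<le> s i \<and>
        dual_norm nn (\<theta> i l *\<^sub>R (V $ l) - transpose V *v \<gamma> i l) \<le> lam \<and>
        0 \<le> \<gamma> i l \<and> 0 \<le> \<theta> i l \<and> 0 \<le> s i)"

definition best_case_multipliers ::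
  "(real ^ 'n \<Rightarrow> real) \<Rightarrow> real ^ 'n ^ 'l \<Rightarrow> nat \<Rightarrow> (nat \<Rightarrow> real ^ 'n) \<Rightarrow> real \<Rightarrow> real ^ 'n \<Rightarrow>
   real \<Rightarrow> (nat \<Rightarrow> real) \<Rightarrow> (nat \<Rightarrow> real ^ 'l) \<Rightarrow> (nat \<Rightarrow> real ^ 'l) \<Rightarrow> bool" where
  "best_case_multipliers nn V N \<xi>h \<alpha> v lam s \<gamma> \<theta> \<longleftrightarrow>
     (\<forall>i\<in>{1..N}.
        1 + \<theta> i \<bullet> (safety_bound V \<alpha> v - V *v \<xi>h i) + \<gamma> i \<bullet> (1 - V *v \<xi>h i) \<le> s i \<and>
        dual_norm nn (transpose V *v \<theta> i + transpose V *v \<gamma> i) \<le> lam \<and>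
        0 \<le> \<gamma> i \<and> 0 \<le> \<theta> i \<and> 0 \<le> s i)"

text \<open>In the best-case program, \<open>z\<close> has to satisfy \<open>z \<le> lam * \<epsilon> + (\<Sum>i=1..N. s i) / real N\<close>
  for all admissible multipliers \<open>lam\<close>, \<open>s\<close>, \<open>\<gamma>\<close>, \<open>\<theta>\<close>, i.e. \<open>z\<close> bounds the optimal value of the dual
  minimisation problem from below. If the multipliers were maximised jointly with \<open>z\<close>, this
  inequality would not restrict \<open>z\<close> at all, and the optimal value would be infinite as soon as some
  \<open>(x, \<alpha>, v)\<close> is feasible:\<close>

lemma best_case_joint_maximisation_unbounded:
  fixes V :: "real ^ 'n ^ 'l"
  assumes "is_norm nn" "N \<ge> 1" "\<epsilon> > 0"
  shows "\<exists>lam s \<gamma> \<theta>. best_case_multipliers nn V N \<xi>h \<alpha> v lam s \<gamma> \<theta> \<and>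
           z \<le> lam * \<epsilon> + (\<Sum>i=1..N. s i) / real N"
proof -
  have "nn 0 = 0" using assms(1) by (simp add: is_norm_def)
  then have ne: "{\<xi>::real^'n. nn \<xi> \<le> 1} \<noteq> {}" by (auto intro!: exI[of _ 0])
  have "dual_norm nn (0::real^'n) = 0" unfolding dual_norm_def using ne by simp
  then have "best_case_multipliers nn V N \<xi>h \<alpha> v (max 0 z / \<epsilon>) (\<lambda>_. 1) (\<lambda>_. 0) (\<lambda>_. 0)"
    using assms(3) by (simp add: best_case_multipliers_def)
  moreover have "z \<le> max 0 z / \<epsilon> * \<epsilon> + (\<Sum>i=1..N. 1) / real N"
    using assms by (simp add: max_def)
  ultimately show ?thesis by blast
qed

end

theory Submission
  imports Defs
begin

text \<open>
  Fix \<open>(\<alpha>, v)\<close>, let \<open>A\<close> be the closed event whose probability is maximised and \<open>D i\<close> the distance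
  from the \<open>i\<close>-th sample to \<open>A \<inter> S\<close>. Moving the mass of sample \<open>i\<close> into \<open>A\<close> costs \<open>D i\<close> per unit, so
  the supremum over the Wasserstein ball is a fractional knapsack problem, whose optimal value is
  \<open>lam * \<epsilon> + (\<Sum>i. max 0 (1 - lam * D i)) / N\<close> for the reciprocal \<open>lam\<close> of the critical distance
  (\<open>lam = 0\<close> if the budget suffices to move everything);
  for every other \<open>lam \<ge> 0\<close> this expression is an upper bound. The multipliers certify lower bounds on
  \<open>lam * D i\<close>: the distance to a polyhedron is dual to the nonnegative combinations of its constraints,
  by separating the polyhedron from an open ball and applying Farkas' lemma to the separating
  functional. In the worst case \<open>A\<close> is a union of half-spaces, so there is one certificate for each
  half-space.
\<close>

section \<open>Norms, dual norms and distances\<close>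

lemma is_norm_zero: "is_norm nn \<Longrightarrow> nn 0 = 0"
  and is_norm_triangle: "is_norm nn \<Longrightarrow> nn (x + y) \<le> nn x + nn y"
  and is_norm_scale: "is_norm nn \<Longrightarrow> nn (c *\<^sub>R x) = \<bar>c\<bar> * nn x"
  and is_norm_eq_0_iff: "is_norm nn \<Longrightarrow> nn x = 0 \<longleftrightarrow> x = 0"
  by (auto simp: is_norm_def)

lemma is_norm_minus: "is_norm nn \<Longrightarrow> nn (- x) = nn x"
  using is_norm_scale[of nn "-1" x] by simp

lemma is_norm_diff_commute: "is_norm nn \<Longrightarrow> nn (x - y) = nn (y - x)"
  using is_norm_minus[of nn "x - y"] by simp

lemma is_norm_nonneg:
  assumes "is_norm nn"
  shows "0 \<le> nn x"
  using is_norm_triangle[OF assms, of x "- x"] is_norm_minus[OF assms, of x] is_norm_zero[OF assms]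
  by simp

lemma is_norm_sum:
  assumes "is_norm nn"
  shows "nn (\<Sum>i\<in>I. f i) \<le> (\<Sum>i\<in>I. nn (f i))"
proof (induction I rule: infinite_finite_induct)
  case (insert i I)
  then show ?case using is_norm_triangle[OF assms, of "f i" "sum f I"] by simp
qed (auto simp: is_norm_zero[OF assms])

lemma is_norm_diff:
  assumes "is_norm nn"
  shows "\<bar>nn x - nn y\<bar> \<le> nn (x - y)"
  using is_norm_triangle[OF assms, of "x - y" y] is_norm_triangle[OF assms, of "y - x" x]
    is_norm_diff_commute[OF assms, of x y] by simp

text \<open>Expanding \<open>x\<close> in the orthonormal basis bounds \<open>nn x\<close> by a
  multiple of the Euclidean norm, so \<open>nn\<close> is Lipschitz, hence continuous and Borel
  measurable.\<close>

lemma is_norm_le_norm: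
  fixes nn :: "'a::euclidean_space \<Rightarrow> real"
  assumes "is_norm nn"
  obtains C where "0 \<le> C" "\<And>x. nn x \<le> C * norm x"
proof
  show "0 \<le> (\<Sum>b\<in>Basis. nn b)"
    by (intro sum_nonneg is_norm_nonneg assms)
  fix x :: 'a
  have "nn x = nn (\<Sum>b\<in>Basis. (x \<bullet> b) *\<^sub>R b)" by (simp add: euclidean_representation)
  also have "\<dots> \<le> (\<Sum>b\<in>Basis. \<bar>x \<bullet> b\<bar> * nn b)"
    using is_norm_sum[OF assms, of "\<lambda>b. (x \<bullet> b) *\<^sub>R b" Basis] by (simp add: is_norm_scale[OF assms])
  also have "\<dots> \<le> (\<Sum>b\<in>Basis. norm x * nn b)"
    by (intro sum_mono mult_right_mono Basis_le_norm is_norm_nonneg assms)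
  finally show "nn x \<le> (\<Sum>b\<in>Basis. nn b) * norm x"
    by (simp add: sum_distrib_left mult.commute)
qed

lemma continuous_on_is_norm:
  fixes nn :: "'a::euclidean_space \<Rightarrow> real"
  assumes "is_norm nn"
  shows "continuous_on S nn"
proof -
  obtain C where C: "0 \<le> C" "\<And>x. nn x \<le> C * norm x" using is_norm_le_norm[OF assms] by metis
  have "C-lipschitz_on S nn"
    by (rule lipschitz_onI)
      (use C is_norm_diff[OF assms] in \<open>auto simp: dist_norm intro: order_trans\<close>)
  then show ?thesis by (rule lipschitz_on_continuous_on)
qed

text \<open>The continuous function \<open>nn\<close> attains its minimum on the compact Euclidean
  unit sphere, and this minimum is positive by definiteness. Homogeneity carries the bound to all
  vectors.\<close>

lemma norm_le_is_norm:
  fixes nn :: "'a::euclidean_space \<Rightarrow> real"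
  assumes "is_norm nn"
  obtains C where "0 \<le> C" "\<And>x. norm x \<le> C * nn x"
proof -
  have "\<exists>u\<in>sphere 0 1. \<forall>w\<in>sphere (0::'a) 1. nn u \<le> nn w"
    by (rule continuous_attains_inf) (auto simp: continuous_on_is_norm[OF assms])
  then obtain u :: 'a where u: "norm u = 1" "\<And>w. norm w = 1 \<Longrightarrow> nn u \<le> nn w" by auto
  have pos: "nn u > 0"
    using is_norm_nonneg[OF assms, of u] is_norm_eq_0_iff[OF assms, of u] u(1) by force
  show ?thesis
  proof
    show "0 \<le> 1 / nn u" using pos by simp
    fix x :: 'a
    show "norm x \<le> 1 / nn u * nn x"
    proof (cases "x = 0")
      case False
      then have "nn u \<le> nn ((1 / norm x) *\<^sub>R x)" by (intro u(2)) simp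
      then show ?thesis using False pos by (simp add: is_norm_scale[OF assms] field_simps)
    qed (simp add: is_norm_zero[OF assms])
  qed
qed

text \<open>The real supremum in \<open>dual_norm\<close> can only be used once its set is known to
  be bounded. This follows from Cauchy-Schwarz, since the \<open>nn\<close>-unit ball is bounded in
  the Euclidean norm.\<close>

lemma bdd_above_dual_norm:
  fixes nn :: "'a::euclidean_space \<Rightarrow> real"
  assumes "is_norm nn"
  shows "bdd_above ((\<lambda>\<xi>. z \<bullet> \<xi>) ` {\<xi>. nn \<xi> \<le> 1})"
proof -
  obtain C where C: "0 \<le> C" "\<And>x. norm x \<le> C * nn x" using norm_le_is_norm[OF assms] by metis
  show ?thesis
  proof (rule bdd_aboveI2)
    fix \<xi> assume "\<xi> \<in> {\<xi>. nn \<xi> \<le> 1}"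
    then have "norm \<xi> \<le> C" using C(2)[of \<xi>] mult_left_mono[of "nn \<xi>" 1 C] C(1) by simp
    then have "norm z * norm \<xi> \<le> norm z * C" by (intro mult_left_mono) auto
    then show "z \<bullet> \<xi> \<le> norm z * C" using norm_cauchy_schwarz[of z \<xi>] by linarith
  qed
qed

lemma inner_le_dual_norm:
  fixes nn :: "'a::euclidean_space \<Rightarrow> real"
  assumes "is_norm nn"
  shows "z \<bullet> x \<le> dual_norm nn z * nn x"
proof (cases "x = 0")
  case False
  then have pos: "nn x > 0" using is_norm_nonneg[OF assms, of x] is_norm_eq_0_iff[OF assms, of x] by force
  have "z \<bullet> ((1 / nn x) *\<^sub>R x) \<le> dual_norm nn z"
    unfolding dual_norm_def
    by (rule cSUP_upper[OF _ bdd_above_dual_norm[OF assms]]) (use pos in \<open>simp add: is_norm_scale[OF assms]\<close>)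
  then show ?thesis using pos by (simp add: field_simps)
qed (simp add: is_norm_zero[OF assms])

lemma dual_norm_le:
  assumes "is_norm nn" and "\<And>\<xi>. nn \<xi> \<le> 1 \<Longrightarrow> z \<bullet> \<xi> \<le> c"
  shows "dual_norm nn z \<le> c"
  unfolding dual_norm_def
  by (rule cSUP_least) (use assms is_norm_zero[OF assms(1)] in \<open>auto intro!: exI[of _ 0]\<close>)

lemma dual_norm_nonneg:
  fixes nn :: "'a::euclidean_space \<Rightarrow> real"
  assumes "is_norm nn"
  shows "0 \<le> dual_norm nn z"
  using cSUP_upper[OF _ bdd_above_dual_norm[OF assms], of 0 z] is_norm_zero[OF assms]
  by (simp add: dual_norm_def)

lemma dual_norm_minus:
  assumes "is_norm nn"
  shows "dual_norm nn (- z) = dual_norm nn z"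
proof -
  have "(\<lambda>\<xi>. - z \<bullet> \<xi>) ` {\<xi>. nn \<xi> \<le> 1} = (\<lambda>\<xi>. z \<bullet> \<xi>) ` uminus ` {\<xi>. nn \<xi> \<le> 1}"
    by (simp add: image_image)
  also have "uminus ` {\<xi>. nn \<xi> \<le> 1} = {\<xi>. nn \<xi> \<le> 1}"
    using is_norm_minus[OF assms] by (auto simp: image_iff) (metis minus_minus)
  finally show ?thesis by (simp add: dual_norm_def)
qed

text \<open>The distances are bounded below by 0, so this real infimum is meaningful for every
  nonempty \<open>K\<close>. For empty \<open>K\<close> it carries no information, hence the
  nonemptiness assumptions below.\<close>

definition norm_dist :: "('a::real_vector \<Rightarrow> real) \<Rightarrow> 'a \<Rightarrow> 'a set \<Rightarrow> real" where
  "norm_dist nn z K = (INF a\<in>K. nn (z - a))"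

lemma norm_dist_le:
  assumes "is_norm nn" "a \<in> K"
  shows "norm_dist nn z K \<le> nn (z - a)"
  unfolding norm_dist_def
  by (rule cINF_lower[OF bdd_belowI2[of _ 0]]) (auto simp: assms is_norm_nonneg)

lemma norm_dist_greatest:
  assumes "K \<noteq> {}" "\<And>a. a \<in> K \<Longrightarrow> c \<le> nn (z - a)"
  shows "c \<le> norm_dist nn z K"
  unfolding norm_dist_def using assms by (rule cINF_greatest)

lemma norm_dist_antimono:
  assumes "is_norm nn" "K \<subseteq> K'" "K \<noteq> {}"
  shows "norm_dist nn z K' \<le> norm_dist nn z K"
  by (rule norm_dist_greatest[OF assms(3)]) (use assms(2) in \<open>auto intro: norm_dist_le[OF assms(1)]\<close>)

lemma norm_dist_nonneg:
  assumes "is_norm nn" "K \<noteq> {}"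
  shows "0 \<le> norm_dist nn z K"
  by (rule norm_dist_greatest[OF assms(2)]) (rule is_norm_nonneg[OF assms(1)])

text \<open>Turns certificates for individual points of \<open>K\<close> into one for the distance.
  The case \<open>lam = 0\<close> is separate because the bound is divided by
  \<open>lam\<close>.\<close>

lemma mult_norm_dist_greatest:
  assumes "0 \<le> lam" "K \<noteq> {}" "\<And>a. a \<in> K \<Longrightarrow> c \<le> lam * nn (z - a)"
  shows "c \<le> lam * norm_dist nn z K"
proof (cases "lam = 0")
  case False
  then have "c / lam \<le> norm_dist nn z K"
    using assms by (intro norm_dist_greatest) (auto simp: field_simps)
  then show ?thesis using False assms(1) by (simp add: field_simps)
qed (use assms in auto)

lemma norm_dist_attained:
  fixes nn :: "'a::euclidean_space \<Rightarrow> real"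
  assumes "is_norm nn" "compact K" "K \<noteq> {}"
  obtains a where "a \<in> K" "nn (z - a) = norm_dist nn z K"
proof -
  have "continuous_on K (\<lambda>a. nn (z - a))"
    by (rule continuous_on_compose2[OF continuous_on_is_norm[OF assms(1), of UNIV]])
      (auto intro!: continuous_intros)
  from continuous_attains_inf[OF assms(2,3) this] obtain a
    where "a \<in> K" "\<And>b. b \<in> K \<Longrightarrow> nn (z - a) \<le> nn (z - b)" by blast
  then show ?thesis
    using that norm_dist_le[OF assms(1)] norm_dist_greatest[OF assms(3)] by (meson order.antisym)
qed

text \<open>The distance is 1-Lipschitz with respect to \<open>nn\<close>, hence Lipschitz with
  respect to the Euclidean norm. This makes the integrand of the transport bound measurable.\<close>

lemma continuous_on_norm_dist:
  fixes nn :: "'a::euclidean_space \<Rightarrow> real"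
  assumes "is_norm nn" "K \<noteq> {}"
  shows "continuous_on S (\<lambda>z. norm_dist nn z K)"
proof -
  obtain C where C: "0 \<le> C" "\<And>x. nn x \<le> C * norm x" using is_norm_le_norm[OF assms(1)] by metis
  have le: "norm_dist nn x K \<le> norm_dist nn y K + nn (x - y)" for x y
  proof -
    have "norm_dist nn x K - nn (x - y) \<le> norm_dist nn y K"
    proof (rule norm_dist_greatest[OF assms(2)])
      fix a assume "a \<in> K"
      then show "norm_dist nn x K - nn (x - y) \<le> nn (y - a)"
        using norm_dist_le[OF assms(1), of a K x] is_norm_triangle[OF assms(1), of "x - y" "y - a"]
        by simp
    qed
    then show ?thesis by simp
  qed
  have "C-lipschitz_on S (\<lambda>z. norm_dist nn z K)"
  proof (rule lipschitz_onI)
    fix x y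
    have "\<bar>norm_dist nn x K - norm_dist nn y K\<bar> \<le> nn (x - y)"
      using le[of x y] le[of y x] is_norm_diff_commute[OF assms(1), of x y] by simp
    then show "dist (norm_dist nn x K) (norm_dist nn y K) \<le> C * dist x y"
      using C(2)[of "x - y"] by (simp add: dist_norm)
  qed (rule C(1))
  then show ?thesis by (rule lipschitz_on_continuous_on)
qed

section \<open>Polyhedral duality\<close>

text \<open>The claim says that \<open>(a, c)\<close> lies in the cone generated by the pairs
  \<open>(g i, h i)\<close> and \<open>(0, 1)\<close>, where \<open>(0, 1)\<close> absorbs slack on
  the right-hand side. A finitely generated cone is closed, so otherwise a hyperplane would separate
  \<open>(a, c)\<close> from it, and its normal yields a point contradicting the
  implication.\<close>

lemma affine_farkas:
  fixes g :: "'i::finite \<Rightarrow> 'a::euclidean_space" and h :: "'i \<Rightarrow> real"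
  assumes x0: "\<And>i. g i \<bullet> x0 \<le> h i"
    and imp: "\<And>x. (\<And>i. g i \<bullet> x \<le> h i) \<Longrightarrow> a \<bullet> x \<le> c"
  obtains y where "\<And>i. 0 \<le> y i" "(\<Sum>i\<in>UNIV. y i *\<^sub>R g i) = a" "(\<Sum>i\<in>UNIV. y i * h i) \<le> c"
proof -
  define G where "G = insert (0, 1) (range (\<lambda>i. (g i, h i)))"
  define C where "C = {((\<Sum>i\<in>UNIV. y i *\<^sub>R g i), (\<Sum>i\<in>UNIV. y i * h i) + t) | y t. (\<forall>i. 0 \<le> y i) \<and> 0 \<le> t}"
  have "convex_cone hull G \<subseteq> C"
  proof (rule hull_minimal)
    show "G \<subseteq> C"
    proof
      fix p assume "p \<in> G"
      then consider "p = (0, 1)" | j where "p = (g j, h j)" by (auto simp: G_def)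
      then show "p \<in> C"
      proof cases
        case 1
        then show ?thesis unfolding C_def by (auto intro!: exI[of _ "\<lambda>_. 0"] exI[of _ 1])
      next
        case 2
        have "(\<Sum>i\<in>UNIV. of_bool (i = j) *\<^sub>R g i) = g j" "(\<Sum>i\<in>UNIV. of_bool (i = j) * h i) = h j"
          by (simp_all add: of_bool_def if_distrib[of "\<lambda>c. c *\<^sub>R _"] if_distrib[of "\<lambda>c. c * _"] cong: if_cong)
        then show ?thesis unfolding C_def using 2
          by (auto intro!: exI[of _ "\<lambda>i. of_bool (i = j)"] exI[of _ 0])
      qed
    qed
    have "0 \<in> C" unfolding C_def by (auto intro!: exI[of _ "\<lambda>_. 0"] exI[of _ 0] simp: zero_prod_def)
    moreover have "p + q \<in> C" if pq: "p \<in> C" "q \<in> C" for p q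
    proof -
      from pq obtain y t y' t' where
        "p = ((\<Sum>i\<in>UNIV. y i *\<^sub>R g i), (\<Sum>i\<in>UNIV. y i * h i) + t)" "\<forall>i. 0 \<le> y i" "0 \<le> t"
        "q = ((\<Sum>i\<in>UNIV. y' i *\<^sub>R g i), (\<Sum>i\<in>UNIV. y' i * h i) + t')" "\<forall>i. 0 \<le> y' i" "0 \<le> t'"
        unfolding C_def by blast
      then show ?thesis unfolding C_def
        by (auto intro!: exI[of _ "\<lambda>i. y i + y' i"] exI[of _ "t + t'"]
            simp: sum.distrib scaleR_add_left distrib_right)
    qed
    moreover have "r *\<^sub>R p \<in> C" if p: "p \<in> C" "0 \<le> r" for p r
    proof -
      from p obtain y t where
        "p = ((\<Sum>i\<in>UNIV. y i *\<^sub>R g i), (\<Sum>i\<in>UNIV. y i * h i) + t)" "\<forall>i. 0 \<le> y i" "0 \<le> t"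
        unfolding C_def by blast
      then show ?thesis unfolding C_def using p(2)
        by (auto intro!: exI[of _ "\<lambda>i. r * y i"] exI[of _ "r * t"]
            simp: scaleR_sum_right sum_distrib_left algebra_simps)
    qed
    ultimately show "convex_cone C" by (simp add: convex_cone_iff)
  qed
  moreover have "(a, c) \<in> convex_cone hull G"
  proof (rule ccontr)
    assume "(a, c) \<notin> convex_cone hull G"
    moreover have "closed (convex_cone hull G)"
      by (rule closed_convex_cone_hull) (simp add: G_def)
    ultimately obtain w b where w: "w \<bullet> (a, c) < b" "\<And>z. z \<in> convex_cone hull G \<Longrightarrow> b < w \<bullet> z"
      using separating_hyperplane_closed_point[OF convex_convex_cone_hull] by meson
    obtain p q where pq: "w = (p, q)" by (cases w)
    have "b < 0" using w(2)[OF convex_cone_hull_contains_0] by simp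
    then have ac: "p \<bullet> a + q * c < 0" using w(1) pq by simp
    \<comment> \<open>A strict lower bound on a cone can only hold if the functional is nonnegative
      there: a point with negative value could be rescaled to have value exactly
      \<open>b\<close>.\<close>
    have pos: "0 \<le> w \<bullet> z" if "z \<in> convex_cone hull G" for z
    proof (rule ccontr)
      assume neg: "\<not> 0 \<le> w \<bullet> z"
      then have "b < w \<bullet> ((b / (w \<bullet> z)) *\<^sub>R z)"
        using \<open>b < 0\<close> by (intro w(2) convex_cone_hull_mul that) (simp add: divide_nonpos_nonpos)
      then show False using neg by simp
    qed
    have "q \<ge> 0" using pos[OF hull_inc, of "(0, 1)"] by (simp add: G_def pq)
    have g: "0 \<le> p \<bullet> g i + q * h i" for i
      using pos[OF hull_inc, of "(g i, h i)"] by (simp add: G_def pq)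
    \<comment> \<open>If \<open>q = 0\<close>, then \<open>- p\<close> is a recession direction along which \<open>a\<close> increases; otherwise \<open>- p / q\<close> violates the implication.\<close>
    show False
    proof (cases "q = 0")
      case True
      \<comment> \<open>This step length raises the value of \<open>a\<close> at \<open>x0\<close>
        by \<open>\<bar>c - a \<bullet> x0\<bar> + 1\<close>, which is enough to exceed
        \<open>c\<close>.\<close>
      define r where "r = (\<bar>c - a \<bullet> x0\<bar> + 1) / - (p \<bullet> a)"
      have "r \<ge> 0" using ac True by (simp add: r_def divide_nonneg_neg)
      have "g i \<bullet> (x0 - r *\<^sub>R p) \<le> h i" for i
        using x0[of i] g[of i] True mult_nonneg_nonneg[OF \<open>0 \<le> r\<close>, of "p \<bullet> g i"]
        by (simp add: inner_diff_right inner_commute)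
      then have "a \<bullet> (x0 - r *\<^sub>R p) \<le> c" by (rule imp)
      moreover have "r * (p \<bullet> a) = - (\<bar>c - a \<bullet> x0\<bar> + 1)" using ac True by (simp add: r_def)
      ultimately show False by (simp add: inner_diff_right inner_commute)
    next
      case False
      then have "q > 0" using \<open>q \<ge> 0\<close> by simp
      have "g i \<bullet> (- (1 / q) *\<^sub>R p) \<le> h i" for i
        using g[of i] \<open>q > 0\<close> by (simp add: field_simps inner_commute)
      then have "a \<bullet> (- (1 / q) *\<^sub>R p) \<le> c" by (rule imp)
      then show False using ac \<open>q > 0\<close> by (simp add: field_simps inner_commute)
    qed
  qed
  ultimately have "(a, c) \<in> C" by blast
  then obtain y t where "\<And>i. 0 \<le> y i" "0 \<le> t"
    "a = (\<Sum>i\<in>UNIV. y i *\<^sub>R g i)" "c = (\<Sum>i\<in>UNIV. y i * h i) + t"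
    unfolding C_def by auto
  then show ?thesis by (intro that[of y]) auto
qed

text \<open>A functional separating the polyhedron from the open ball of radius \<open>d\<close>
  around \<open>z\<close> has a gap of at least \<open>d\<close> times its dual norm. Farkas' lemma
  writes it as a nonnegative combination of the constraints, and rescaling adapts its dual norm to
  the prescribed \<open>lam\<close>. At distance zero the zero multipliers suffice.\<close>

lemma norm_dist_polyhedron_dual:
  fixes g :: "'i::finite \<Rightarrow> 'a::euclidean_space" and nn :: "'a \<Rightarrow> real"
  assumes nn: "is_norm nn" and ne: "{x. \<forall>i. g i \<bullet> x \<le> h i} \<noteq> {}" and lam: "0 \<le> lam"
  obtains y where "\<And>i. 0 \<le> y i" "dual_norm nn (\<Sum>i\<in>UNIV. y i *\<^sub>R g i) \<le> lam"
    "lam * norm_dist nn z {x. \<forall>i. g i \<bullet> x \<le> h i} \<le> (\<Sum>i\<in>UNIV. y i * (g i \<bullet> z - h i))"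
proof -
  define P where "P = {x. \<forall>i. g i \<bullet> x \<le> h i}"
  define d where "d = norm_dist nn z P"
  show ?thesis
  proof (cases "d \<le> 0")
    case True
    have "lam * d \<le> 0" using True lam by (simp add: mult_nonneg_nonpos)
    moreover have "dual_norm nn 0 \<le> lam" using lam by (intro dual_norm_le[OF nn]) simp
    ultimately show ?thesis using that[of "\<lambda>_. 0"] by (simp add: P_def d_def)
  next
    case False
    then have "d > 0" by simp
    define B where "B = {w. nn (w - z) < d}"
    have P_alt: "P = (\<Inter>i. {x. g i \<bullet> x \<le> h i})" by (auto simp: P_def)
    have "convex P" unfolding P_alt by (intro convex_INT convex_halfspace_le)
    moreover have "convex B"
    proof (rule convexI)
      fix x y :: 'a and u v :: real
      assume xy: "x \<in> B" "y \<in> B" and uv: "0 \<le> u" "0 \<le> v" "u + v = 1"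
      have "u *\<^sub>R x + v *\<^sub>R y - (u *\<^sub>R z + v *\<^sub>R z) = u *\<^sub>R (x - z) + v *\<^sub>R (y - z)"
        by (simp add: scaleR_diff_right)
      then have eq: "u *\<^sub>R x + v *\<^sub>R y - z = u *\<^sub>R (x - z) + v *\<^sub>R (y - z)"
        using uv(3) by (simp flip: scaleR_add_left)
      have "nn (u *\<^sub>R x + v *\<^sub>R y - z) \<le> u * nn (x - z) + v * nn (y - z)"
        unfolding eq using is_norm_triangle[OF nn, of "u *\<^sub>R (x - z)" "v *\<^sub>R (y - z)"] uv
        by (simp add: is_norm_scale[OF nn])
      also have "\<dots> < d" using xy uv by (intro convex_bound_lt) (auto simp: B_def)
      finally show "u *\<^sub>R x + v *\<^sub>R y \<in> B" by (simp add: B_def)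
    qed
    moreover have "P \<noteq> {}" using ne by (simp add: P_def)
    moreover have "B \<noteq> {}" using \<open>d > 0\<close> is_norm_zero[OF nn] by (auto simp: B_def intro!: exI[of _ z])
    moreover have "P \<inter> B = {}"
      using norm_dist_le[OF nn, of _ P z] is_norm_diff_commute[OF nn, of z] by (force simp: B_def d_def)
    ultimately obtain a b where a: "a \<noteq> 0" "\<And>x. x \<in> P \<Longrightarrow> a \<bullet> x \<le> b" "\<And>x. x \<in> B \<Longrightarrow> b \<le> a \<bullet> x"
      using separating_hyperplane_sets[of P B] by metis
    \<comment> \<open>The ball is open, so the separation is evaluated at \<open>z - t \<xi>\<close>
      for \<open>t < d\<close> only, and the bound at radius \<open>d\<close> is obtained as
      \<open>t\<close> tends to \<open>d\<close> from the left.\<close>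
    have dn: "d * dual_norm nn a \<le> a \<bullet> z - b"
    proof -
      have "dual_norm nn a \<le> (a \<bullet> z - b) / d"
      proof (rule dual_norm_le[OF nn])
        fix \<xi> assume \<xi>: "nn \<xi> \<le> 1"
        have "t * (a \<bullet> \<xi>) \<le> a \<bullet> z - b" if t: "0 < t" "t < d" for t
        proof -
          have "t * nn \<xi> \<le> t" using \<xi> t mult_left_mono[of "nn \<xi>" 1 t] by simp
          then have "t * nn \<xi> < d" using t by linarith
          then have "z - t *\<^sub>R \<xi> \<in> B"
            using t is_norm_minus[OF nn, of "t *\<^sub>R \<xi>"] by (simp add: B_def is_norm_scale[OF nn])
          from a(3)[OF this] show ?thesis by (simp add: inner_diff_right)
        qed
        then have ev: "\<forall>\<^sub>F t in at_left d. t * (a \<bullet> \<xi>) \<le> a \<bullet> z - b"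
          using \<open>d > 0\<close> by (auto simp: eventually_at_left_field intro!: exI[of _ 0])
        have "((\<lambda>t. t * (a \<bullet> \<xi>)) \<longlongrightarrow> d * (a \<bullet> \<xi>)) (at_left d)" by (intro tendsto_intros)
        then have "d * (a \<bullet> \<xi>) \<le> a \<bullet> z - b"
          using ev by (rule tendsto_upperbound) simp
        then show "a \<bullet> \<xi> \<le> (a \<bullet> z - b) / d" using \<open>d > 0\<close> by (simp add: field_simps)
      qed
      then show ?thesis using \<open>d > 0\<close> by (simp add: field_simps)
    qed
    have "dual_norm nn a > 0"
    proof -
      have "0 < dual_norm nn a * nn a" using inner_le_dual_norm[OF nn, of a a] a(1)
        by (metis inner_gt_zero_iff order_less_le_trans)
      then show ?thesis using is_norm_nonneg[OF nn, of a] by (simp add: zero_less_mult_iff)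
    qed
    \<comment> \<open>With this factor the dual norm of the functional drops to at most
      \<open>lam\<close>, while the gap \<open>d * dual_norm nn a\<close> becomes
      \<open>lam * d\<close>.\<close>
    define r where "r = lam / dual_norm nn a"
    have "r \<ge> 0" using \<open>dual_norm nn a > 0\<close> lam by (simp add: r_def)
    obtain x0 where x0: "x0 \<in> P" using \<open>P \<noteq> {}\<close> by blast
    obtain y where y: "\<And>i. 0 \<le> y i" "(\<Sum>i\<in>UNIV. y i *\<^sub>R g i) = a" "(\<Sum>i\<in>UNIV. y i * h i) \<le> b"
      by (rule affine_farkas[of g x0 h a b]) (use x0 a(2) in \<open>auto simp: P_def\<close>)
    have ra: "(\<Sum>i\<in>UNIV. (r * y i) *\<^sub>R g i) = r *\<^sub>R a"
      by (simp flip: y(2) add: scaleR_sum_right)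
    show ?thesis
    proof (rule that[of "\<lambda>i. r * y i"])
      show "0 \<le> r * y i" for i using y(1) \<open>r \<ge> 0\<close> by simp
      show "dual_norm nn (\<Sum>i\<in>UNIV. (r * y i) *\<^sub>R g i) \<le> lam"
        unfolding ra
      proof (rule dual_norm_le[OF nn])
        fix \<xi> assume "nn \<xi> \<le> 1"
        then have "a \<bullet> \<xi> \<le> dual_norm nn a"
          using inner_le_dual_norm[OF nn, of a \<xi>] mult_left_mono[of "nn \<xi>" 1 "dual_norm nn a"]
            \<open>dual_norm nn a > 0\<close> by linarith
        then have "r * (a \<bullet> \<xi>) \<le> r * dual_norm nn a" using \<open>r \<ge> 0\<close> by (rule mult_left_mono)
        then show "r *\<^sub>R a \<bullet> \<xi> \<le> lam" using \<open>dual_norm nn a > 0\<close> by (simp add: r_def)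
      qed
      have "(\<Sum>i\<in>UNIV. y i * (g i \<bullet> z - h i)) = (\<Sum>i\<in>UNIV. y i *\<^sub>R g i) \<bullet> z - (\<Sum>i\<in>UNIV. y i * h i)"
        by (simp add: inner_sum_left right_diff_distrib sum_subtractf)
      then have "d * dual_norm nn a \<le> (\<Sum>i\<in>UNIV. y i * (g i \<bullet> z - h i))" using y dn by simp
      then have "r * (d * dual_norm nn a) \<le> r * (\<Sum>i\<in>UNIV. y i * (g i \<bullet> z - h i))"
        using \<open>r \<ge> 0\<close> by (rule mult_left_mono)
      then show "lam * norm_dist nn z {x. \<forall>i. g i \<bullet> x \<le> h i} \<le> (\<Sum>i\<in>UNIV. r * y i * (g i \<bullet> z - h i))"
        using \<open>dual_norm nn a > 0\<close>
        by (simp add: r_def sum_distrib_left mult.assoc flip: P_def d_def)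
    qed
  qed
qed

section \<open>The fractional knapsack problem\<close>

text \<open>Linear programming duality with explicit optimal solutions: \<open>w\<close> fills the
  cheapest items first, and \<open>lam\<close> is the price of the budget. The last conclusion says
  that the dual objective at \<open>lam\<close> equals the primal objective at \<open>w\<close>. If
  everything fits, the price is 0.\<close>

lemma fractional_knapsack:
  fixes d :: "'i \<Rightarrow> real"
  assumes fin: "finite I" and d: "\<And>i. i \<in> I \<Longrightarrow> 0 \<le> d i" and B: "0 \<le> B"
  obtains w lam where "\<And>i. 0 \<le> w i" "\<And>i. w i \<le> 1" "0 \<le> lam" "(\<Sum>i\<in>I. w i * d i) \<le> B"
    "lam * B + (\<Sum>i\<in>I. max 0 (1 - lam * d i)) = (\<Sum>i\<in>I. w i)"
proof (cases "sum d I \<le> B")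
  case True
  then show ?thesis using that[of "\<lambda>_. 1" 0] by simp
next
  case False
  define F where "F t = (\<Sum>i\<in>{i\<in>I. d i \<le> t}. d i)" for t
  \<comment> \<open>\<open>F t\<close> is the cost of filling all items of unit cost at most \<open>t\<close>; the critical item is the first that breaks the budget.\<close>
  define T where "T = {t \<in> d ` I. F t > B}"
  have "I \<noteq> {}" using False B by auto
  then have "{i\<in>I. d i \<le> Max (d ` I)} = I" using fin by auto
  then have "Max (d ` I) \<in> T" using False fin \<open>I \<noteq> {}\<close> by (simp add: T_def F_def)
  moreover have "finite T" using fin by (simp add: T_def)
  ultimately have tT: "Min T \<in> T" by (intro Min_in) auto
  define t where "t = Min T"
  define Lo where "Lo = {i\<in>I. d i < t}"
  define E where "E = {i\<in>I. d i = t}"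
  have fins: "finite Lo" "finite E" using fin by (auto simp: Lo_def E_def)
  have disj: "Lo \<inter> E = {}" by (auto simp: Lo_def E_def)
  \<comment> \<open>The largest unit cost \<open>t'\<close> below \<open>t\<close> is not in
    \<open>T\<close> by minimality of \<open>t\<close>, and filling up to cost \<open>t'\<close>
    fills exactly \<open>Lo\<close>.\<close>
  have Lo_le: "sum d Lo \<le> B"
  proof (cases "Lo = {}")
    case False
    define t' where "t' = Max (d ` Lo)"
    have "t' \<in> d ` Lo" unfolding t'_def using False fins by (intro Max_in) auto
    then have "t' < t" "t' \<in> d ` I" by (auto simp: Lo_def)
    have "{i\<in>I. d i \<le> t'} = Lo"
    proof
      show "{i\<in>I. d i \<le> t'} \<subseteq> Lo" using \<open>t' < t\<close> by (auto simp: Lo_def)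
      show "Lo \<subseteq> {i\<in>I. d i \<le> t'}" using fins by (auto simp: t'_def Lo_def)
    qed
    moreover have "t' \<notin> T" using \<open>t' < t\<close> Min_le[OF \<open>finite T\<close>, of t'] by (auto simp: t_def)
    ultimately show ?thesis using \<open>t' \<in> d ` I\<close> by (auto simp: T_def F_def)
  qed (use B in simp)
  have "{i\<in>I. d i \<le> t} = Lo \<union> E" by (auto simp: Lo_def E_def)
  then have "B < sum d (Lo \<union> E)" using tT by (simp add: T_def F_def t_def)
  also have "\<dots> = sum d Lo + t * card E"
    using fins disj by (simp add: sum.union_disjoint) (simp add: E_def)
  finally have gt: "B < sum d Lo + t * card E" .
  have "0 \<le> t" using tT d by (auto simp: T_def t_def)
  have tE: "0 < t * card E" using gt Lo_le by simp
  then have "0 < t" "0 < card E" using \<open>0 \<le> t\<close> by (auto simp: zero_less_mult_iff)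
  \<comment> \<open>All items tied at the critical cost receive the same fraction, chosen so that
    they use up exactly the remaining budget.\<close>
  define \<rho> where "\<rho> = (B - sum d Lo) / (t * card E)"
  have \<rho>: "0 \<le> \<rho>" "\<rho> \<le> 1" "\<rho> * (t * card E) = B - sum d Lo"
    using tE gt Lo_le by (auto simp: \<rho>_def)
  define w where "w i = (if d i < t then 1 else if d i = t then \<rho> else 0)" for i
  have split: "sum f I = sum f Lo + sum f E" if "\<And>i. i \<in> I \<Longrightarrow> d i > t \<Longrightarrow> f i = 0" for f :: "'i \<Rightarrow> real"
  proof -
    have "sum f I = sum f (Lo \<union> E)"
      using that fin by (intro sum.mono_neutral_right)
        (auto simp: Lo_def E_def intro: linorder_neqE_linordered_idom)
    then show ?thesis using fins disj by (simp add: sum.union_disjoint)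
  qed
  show ?thesis
  \<comment> \<open>At price \<open>1 / t\<close> an item has positive dual profit exactly when it
    is cheaper than \<open>t\<close>, that is, when it is filled completely. This complementary
    slackness makes the two objectives agree.\<close>
  proof (rule that[of w "1 / t"])
    show "0 \<le> w i" "w i \<le> 1" for i using \<rho> by (auto simp: w_def)
    show "0 \<le> 1 / t" using \<open>0 < t\<close> by simp
    have "(\<Sum>i\<in>I. w i * d i) = sum d Lo + (\<Sum>i\<in>E. \<rho> * t)"
      by (subst split) (auto simp: w_def Lo_def E_def intro!: arg_cong2[where f = "(+)"] sum.cong)
    then show "(\<Sum>i\<in>I. w i * d i) \<le> B" using \<rho>(3) by (simp add: mult_ac)
    have "(\<Sum>i\<in>I. w i) = card Lo + card E * \<rho>"
      by (subst split) (auto simp: w_def Lo_def E_def)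
    moreover have "(\<Sum>i\<in>I. max 0 (1 - 1 / t * d i)) = (\<Sum>i\<in>Lo. 1 - 1 / t * d i)"
    proof -
      have "(\<Sum>i\<in>I. max 0 (1 - 1 / t * d i))
          = (\<Sum>i\<in>Lo. max 0 (1 - 1 / t * d i)) + (\<Sum>i\<in>E. max 0 (1 - 1 / t * d i))"
        using \<open>0 < t\<close> by (intro split) (auto simp: field_simps)
      also have "(\<Sum>i\<in>E. max 0 (1 - 1 / t * d i)) = 0"
        using \<open>0 < t\<close> by (intro sum.neutral) (auto simp: E_def)
      also have "(\<Sum>i\<in>Lo. max 0 (1 - 1 / t * d i)) = (\<Sum>i\<in>Lo. 1 - 1 / t * d i)"
        using \<open>0 < t\<close> by (intro sum.cong) (auto simp: Lo_def field_simps)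
      finally show ?thesis by simp
    qed
    moreover have "(\<Sum>i\<in>Lo. 1 - 1 / t * d i) = card Lo - sum d Lo / t"
      by (simp add: sum_subtractf sum_divide_distrib)
    moreover have "B / t - sum d Lo / t = card E * \<rho>"
      using \<rho>(3) \<open>0 < t\<close> by (simp add: field_simps)
    ultimately show "1 / t * B + (\<Sum>i\<in>I. max 0 (1 - 1 / t * d i)) = (\<Sum>i\<in>I. w i)"
      by simp
  qed
qed

section \<open>Transport to the empirical distribution\<close>

lemma sets_empirical: "sets (empirical N \<xi>h) = sets borel"
  by (simp add: empirical_def)

lemma nn_integral_empirical:
  assumes "N \<ge> 1" "g \<in> borel_measurable borel" "\<And>z. 0 \<le> g z"
  shows "(\<integral>\<^sup>+ z. ennreal (g z) \<partial>empirical N \<xi>h) = ennreal ((\<Sum>i=1..N. g (\<xi>h i)) / real N)"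
proof -
  have "(\<integral>\<^sup>+ z. ennreal (g z) \<partial>empirical N \<xi>h)
      = (\<integral>\<^sup>+ i. ennreal (g (\<xi>h i)) \<partial>uniform_count_measure {1..N})"
  proof -
    have "\<xi>h \<in> measurable (uniform_count_measure {1..N}) borel"
      by (auto simp: measurable_def space_uniform_count_measure sets_uniform_count_measure)
    then show ?thesis unfolding empirical_def using assms(2) by (subst nn_integral_distr) auto
  qed
  also have "\<dots> = (\<Sum>i=1..N. ennreal (1 / real N) * ennreal (g (\<xi>h i)))"
    unfolding uniform_count_measure_def by (subst nn_integral_point_measure_finite) auto
  also have "\<dots> = (\<Sum>i=1..N. ennreal (g (\<xi>h i) / real N))"
    by (simp flip: ennreal_mult' add: assms)
  also have "\<dots> = ennreal (\<Sum>i=1..N. g (\<xi>h i) / real N)"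
    using assms by (intro sum_ennreal) auto
  finally show ?thesis by (simp add: sum_divide_distrib)
qed

text \<open>Weak duality. If a coupling moves mass between a point of \<open>A \<inter> S\<close>
  and a sample \<open>y\<close>, then 1 is at most \<open>lam\<close> times the transport distance
  plus \<open>max 0 (1 - lam * D)\<close>, where \<open>D\<close> is the distance from
  \<open>y\<close> to \<open>A \<inter> S\<close>. Integrating this against a coupling bounds the
  probability of \<open>A\<close>.\<close>

lemma wasserstein_ball_measure_le:
  fixes nn :: "'a::euclidean_space \<Rightarrow> real"
  assumes nn: "is_norm nn" and N: "N \<ge> 1" and \<epsilon>: "0 < \<epsilon>" and lam: "0 \<le> lam"
    and A: "closed A" and ne: "A \<inter> S \<noteq> {}"
    and Q: "Q \<in> wasserstein_ball nn S \<epsilon> (empirical N \<xi>h)"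
  shows "measure Q A \<le> lam * \<epsilon> + (\<Sum>i=1..N. max 0 (1 - lam * norm_dist nn (\<xi>h i) (A \<inter> S))) / real N"
proof -
  let ?P = "empirical N \<xi>h" and ?K = "A \<inter> S"
  define g where "g z = max 0 (1 - lam * norm_dist nn z ?K)" for z
  define G where "G = (\<Sum>i=1..N. g (\<xi>h i)) / real N"
  have G0: "0 \<le> G" by (auto simp: G_def g_def intro!: divide_nonneg_nonneg sum_nonneg)
  interpret Q: prob_space Q using Q by (simp add: wasserstein_ball_def prob_dists_def)
  have sQ: "sets Q = sets borel" and QS: "measure Q S = 1" and W: "wasserstein nn Q ?P \<le> ennreal \<epsilon>"
    using Q by (auto simp: wasserstein_ball_def prob_dists_def)
  \<comment> \<open>Non-measurable sets have \<open>measure\<close> 0, so probability 1 forces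
    measurability.\<close>
  have S: "S \<in> sets borel" using QS measure_notin_sets[of S Q] sQ by fastforce
  have Ab: "A \<in> sets borel" using A by simp
  have K: "?K \<in> sets borel" using S Ab by simp
  have QA: "measure Q A = measure Q ?K"
    by (rule measure_eq_AE) (use QS S Ab sQ K in \<open>auto simp: Q.AE_in_set_eq_1[symmetric]\<close>)
  have gm: "g \<in> borel_measurable borel"
    unfolding g_def by (intro borel_measurable_continuous_onI continuous_intros continuous_on_norm_dist nn ne)
  have nnm: "nn \<in> borel_measurable borel"
    by (intro borel_measurable_continuous_onI continuous_on_is_norm nn)
  \<comment> \<open>The Wasserstein distance is an infimum, so a coupling is only taken with cost
    below \<open>\<epsilon> + \<delta>\<close>, and \<open>\<delta>\<close> is removed at the
    end.\<close>
  have bound: "measure Q A \<le> lam * (\<epsilon> + \<delta>) + G" if "\<delta> > 0" for \<delta>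
  proof -
    have "wasserstein nn Q ?P < ennreal (\<epsilon> + \<delta>)"
      using W \<epsilon> that by (meson ennreal_lessI le_less_trans less_add_same_cancel1 add_pos_pos)
    then obtain J where J: "J \<in> couplings Q ?P"
      and cost: "(\<integral>\<^sup>+ w. ennreal (nn (fst w - snd w)) \<partial>J) < ennreal (\<epsilon> + \<delta>)"
      unfolding wasserstein_def INF_less_iff by blast
    have sJ: "sets J = sets (Q \<Otimes>\<^sub>M ?P)" and J1: "distr J Q fst = Q" and J2: "distr J ?P snd = ?P"
      using J by (auto simp: couplings_def)
    have sJb: "sets J = sets (borel \<Otimes>\<^sub>M borel)"
      unfolding sJ by (intro sets_pair_measure_cong sQ sets_empirical)
    have fstm: "fst \<in> measurable J Q" and sndm: "snd \<in> measurable J ?P"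
      using measurable_cong_sets[OF sJ refl] by (auto)
    have fstb: "fst \<in> measurable J borel" and sndb: "snd \<in> measurable J borel"
      using measurable_cong_sets[OF sJb refl] by auto
    have "ennreal (measure Q A) = emeasure Q ?K" by (simp add: QA Q.emeasure_eq_measure)
    also have "\<dots> = (\<integral>\<^sup>+ a. indicator ?K a \<partial>distr J Q fst)"
      using K sQ by (simp add: J1)
    also have "\<dots> = (\<integral>\<^sup>+ w. indicator ?K (fst w) \<partial>J)"
      by (subst nn_integral_distr[OF fstm]) (use K sQ in auto)
    also have "\<dots> \<le> (\<integral>\<^sup>+ w. ennreal lam * ennreal (nn (fst w - snd w)) + ennreal (g (snd w)) \<partial>J)"
    proof (rule nn_integral_mono)
      fix w
      have "1 \<le> lam * nn (fst w - snd w) + g (snd w)" if "fst w \<in> ?K"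
        using mult_left_mono[OF norm_dist_le[OF nn that, of "snd w"] lam]
          is_norm_diff_commute[OF nn, of "snd w" "fst w"] by (simp add: g_def)
      then have "(indicator ?K (fst w) :: ennreal) \<le> ennreal (lam * nn (fst w - snd w) + g (snd w))"
        by (auto simp: indicator_def simp flip: ennreal_1 intro: ennreal_leI)
      also have "\<dots> = ennreal lam * ennreal (nn (fst w - snd w)) + ennreal (g (snd w))"
        using lam is_norm_nonneg[OF nn] by (subst ennreal_plus) (auto simp: ennreal_mult g_def)
      finally show "indicator ?K (fst w) \<le> ennreal lam * ennreal (nn (fst w - snd w)) + ennreal (g (snd w))" .
    qed
    also have "\<dots> = ennreal lam * (\<integral>\<^sup>+ w. ennreal (nn (fst w - snd w)) \<partial>J) + (\<integral>\<^sup>+ w. ennreal (g (snd w)) \<partial>J)"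
      using fstb sndb nnm gm by (subst nn_integral_add) (auto intro!: nn_integral_cmult)
    also have "(\<integral>\<^sup>+ w. ennreal (g (snd w)) \<partial>J) = (\<integral>\<^sup>+ z. ennreal (g z) \<partial>distr J ?P snd)"
      by (subst nn_integral_distr[OF sndm]) (use gm in \<open>auto simp: measurable_cong_sets[OF sets_empirical refl]\<close>)
    also have "\<dots> = ennreal G"
      unfolding J2 G_def by (rule nn_integral_empirical[OF N gm]) (simp add: g_def)
    also have "ennreal lam * (\<integral>\<^sup>+ w. ennreal (nn (fst w - snd w)) \<partial>J) + ennreal G
        \<le> ennreal lam * ennreal (\<epsilon> + \<delta>) + ennreal G"
      using cost by (intro add_mono mult_left_mono) auto
    also have "\<dots> = ennreal (lam * (\<epsilon> + \<delta>) + G)"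
      using lam \<epsilon> that G0 by (subst ennreal_plus) (auto simp: ennreal_mult)
    finally show ?thesis
      using lam \<epsilon> that G0 by (subst (asm) ennreal_le_iff) auto
  qed
  have "measure Q A \<le> lam * \<epsilon> + G"
  proof (rule field_le_epsilon)
    fix e :: real assume "e > 0"
    \<comment> \<open>The added 1 keeps the denominator positive when
      \<open>lam = 0\<close>.\<close>
    define \<delta> where "\<delta> = e / (lam + 1)"
    have "\<delta> > 0" "lam * \<delta> \<le> e" using lam \<open>e > 0\<close> by (auto simp: \<delta>_def field_simps)
    then show "measure Q A \<le> lam * \<epsilon> + G + e" using bound[of \<delta>] by (simp add: distrib_left)
  qed
  then show ?thesis by (simp add: G_def g_def)
qed

text \<open>Realises a transport plan within the budget by a distribution in the ball. The joint law
  of the moved point and the original sample is the coupling that witnesses the bound on the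
  distance.\<close>

lemma ex_wasserstein_ball_transport:
  fixes nn :: "'a::euclidean_space \<Rightarrow> real"
  assumes nn: "is_norm nn" and N: "N \<ge> 1" and A: "closed A" and S: "S \<in> sets borel"
    and \<xi>h: "\<And>i. i \<in> {1..N} \<Longrightarrow> \<xi>h i \<in> S" and a: "\<And>i. a i \<in> A \<inter> S"
    and w: "\<And>i. 0 \<le> w i" "\<And>i. w i \<le> 1"
    and cost: "(\<Sum>i=1..N. w i * nn (\<xi>h i - a i)) \<le> real N * \<epsilon>"
  shows "\<exists>Q\<in>wasserstein_ball nn S \<epsilon> (empirical N \<xi>h). (\<Sum>i=1..N. w i) / real N \<le> measure Q A"
proof -
  \<comment> \<open>A sample index is drawn uniformly, and its mass is moved with probability \<open>w i\<close>.\<close>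
  define p where "p = bind_pmf (pmf_of_set {1..N}) (\<lambda>i. map_pmf (Pair i) (bernoulli_pmf (w i)))"
  define x where "x k = (if snd k then a (fst k) else \<xi>h (fst k))" for k
  define z where "z k = \<xi>h (fst k)" for k :: "nat \<times> bool"
  define Q where "Q = distr (measure_pmf p) borel x"
  define J where "J = distr (measure_pmf p) (borel \<Otimes>\<^sub>M borel) (\<lambda>k. (x k, z k))"
  let ?P = "empirical N \<xi>h"
  have ne: "{1..N} \<noteq> {}" using N by simp
  have int: "(\<integral>\<^sup>+ k. ennreal (F k) \<partial>measure_pmf p)
      = ennreal ((\<Sum>i=1..N. w i * F (i, True) + (1 - w i) * F (i, False)) / real N)"
    if F: "\<And>k. 0 \<le> F k" for F
  proof -
    have "(\<integral>\<^sup>+ k. ennreal (F k) \<partial>measure_pmf p)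
        = (\<integral>\<^sup>+ i. \<integral>\<^sup>+ b. ennreal (F (i, b)) \<partial>bernoulli_pmf (w i) \<partial>pmf_of_set {1..N})"
      by (simp add: p_def)
    also have "\<dots> = (\<integral>\<^sup>+ i. ennreal (w i * F (i, True) + (1 - w i) * F (i, False)) \<partial>pmf_of_set {1..N})"
      using w F by (intro nn_integral_cong) (simp add: ennreal_plus ennreal_mult' mult.commute)
    also have "\<dots> = (\<Sum>i=1..N. ennreal (w i * F (i, True) + (1 - w i) * F (i, False))) / ennreal (real N)"
      using ne by (subst nn_integral_pmf_of_set) (auto simp: ennreal_of_nat_eq_real_of_nat)
    also have "(\<Sum>i=1..N. ennreal (w i * F (i, True) + (1 - w i) * F (i, False)))
        = ennreal (\<Sum>i=1..N. w i * F (i, True) + (1 - w i) * F (i, False))"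
      using w F by (intro sum_ennreal) auto
    also have "\<dots> / real N = ennreal ((\<Sum>i=1..N. w i * F (i, True) + (1 - w i) * F (i, False)) / real N)"
      using w F N by (intro divide_ennreal sum_nonneg) auto
    finally show ?thesis .
  qed
  have supp: "set_pmf p \<subseteq> {1..N} \<times> UNIV" using ne by (auto simp: p_def)
  then have finp: "finite (set_pmf p)" by (rule finite_subset) auto
  have xS: "x k \<in> S" if "k \<in> set_pmf p" for k
    using that supp \<xi>h a by (auto simp: x_def)
  \<comment> \<open>\<open>z\<close> ignores whether the mass is moved, so the two weights
    \<open>w i\<close> and \<open>1 - w i\<close> add up to 1.\<close>
  have distr_z: "distr (measure_pmf p) borel z = ?P"
  proof (rule measure_eqI)
    fix B assume "B \<in> sets (distr (measure_pmf p) borel z)"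
    then have B: "B \<in> sets borel" by simp
    have "emeasure (distr (measure_pmf p) borel z) B
        = (\<integral>\<^sup>+ x. indicator B x \<partial>distr (measure_pmf p) borel z)"
      using B by simp
    also have "\<dots> = (\<integral>\<^sup>+ k. indicator B (z k) \<partial>measure_pmf p)"
      by (subst nn_integral_distr) (use B in auto)
    also have "\<dots> = (\<integral>\<^sup>+ k. ennreal (indicator B (z k)) \<partial>measure_pmf p)"
      by (simp add: ennreal_indicator)
    also have "\<dots> = ennreal ((\<Sum>i=1..N. w i * indicator B (\<xi>h i) + (1 - w i) * indicator B (\<xi>h i)) / real N)"
      by (subst int) (auto simp: z_def)
    also have "\<dots> = emeasure ?P B"
      by (simp add: emeasure_empirical[OF N B] flip: distrib_right)
    finally show "emeasure (distr (measure_pmf p) borel z) B = emeasure ?P B" .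
  qed (simp add: sets_empirical)
  interpret Q: prob_space Q unfolding Q_def by (rule measure_pmf.prob_space_distr) simp
  have sQ: "sets Q = sets borel" by (simp add: Q_def)
  have nnm: "nn \<in> borel_measurable borel"
    by (intro borel_measurable_continuous_onI continuous_on_is_norm nn)
  have "measure Q S = 1"
    unfolding Q_def using S xS
    by (subst measure_distr) (auto simp: measure_pmf.prob_eq_1 AE_measure_pmf_iff)
  moreover have "integrable Q nn"
    unfolding Q_def by (subst integrable_distr_eq) (auto simp: nnm intro: integrable_measure_pmf_finite finp)
  ultimately have Qd: "Q \<in> prob_dists nn S"
    by (simp add: prob_dists_def Q.prob_space_axioms sQ)
  have sP: "sets (Q \<Otimes>\<^sub>M ?P) = sets (borel \<Otimes>\<^sub>M borel)"
    by (intro sets_pair_measure_cong sQ sets_empirical)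
  have "distr J Q fst = distr J borel fst" by (rule distr_cong) (auto simp: sQ)
  also have "\<dots> = Q" unfolding J_def Q_def by (subst distr_distr) (auto simp: space_pair_measure comp_def)
  finally have J1: "distr J Q fst = Q" .
  have "distr J ?P snd = distr J borel snd" by (rule distr_cong) (auto simp: sets_empirical)
  also have "\<dots> = ?P" unfolding J_def by (subst distr_distr) (auto simp: space_pair_measure comp_def distr_z)
  finally have J2: "distr J ?P snd = ?P" .
  have "J \<in> couplings Q ?P" by (simp add: couplings_def J1 J2 sP) (simp add: J_def)
  then have "wasserstein nn Q ?P \<le> (\<integral>\<^sup>+ w. ennreal (nn (fst w - snd w)) \<partial>J)"
    unfolding wasserstein_def by (rule INF_lower)
  also have "\<dots> = (\<integral>\<^sup>+ k. ennreal (nn (x k - z k)) \<partial>measure_pmf p)"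
    unfolding J_def using nnm by (subst nn_integral_distr) (auto simp: space_pair_measure)
  also have "\<dots> = ennreal ((\<Sum>i=1..N. w i * nn (\<xi>h i - a i)) / real N)"
    by (subst int) (auto simp: x_def z_def is_norm_nonneg[OF nn] is_norm_zero[OF nn] is_norm_diff_commute[OF nn, of "a _"])
  also have "\<dots> \<le> ennreal \<epsilon>" using cost N by (intro ennreal_leI) (simp add: field_simps)
  finally have "Q \<in> wasserstein_ball nn S \<epsilon> ?P" using Qd by (simp add: wasserstein_ball_def)
  moreover have "(\<Sum>i=1..N. w i) / real N \<le> measure Q A"
  proof -
    \<comment> \<open>All moved mass lies in \<open>A\<close>. Unmoved mass may lie there too, so
      this is only a lower bound.\<close>
    have "ennreal ((\<Sum>i=1..N. w i) / real N) \<le>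
        ennreal ((\<Sum>i=1..N. w i * indicator A (a i) + (1 - w i) * indicator A (\<xi>h i)) / real N)"
      using a w by (intro ennreal_leI divide_right_mono sum_mono) (auto simp: indicator_def)
    also have "\<dots> = (\<integral>\<^sup>+ k. ennreal (indicator A (x k)) \<partial>measure_pmf p)"
      by (subst int) (auto simp: x_def)
    also have "\<dots> = (\<integral>\<^sup>+ k. indicator A k \<partial>Q)"
      unfolding Q_def using A by (subst nn_integral_distr) (auto simp: ennreal_indicator)
    also have "\<dots> = ennreal (measure Q A)"
      using A sQ by (simp add: Q.emeasure_eq_measure)
    finally show ?thesis by (simp add: ennreal_le_iff)
  qed
  ultimately show ?thesis by blast
qed

text \<open>Strong duality for a fixed event. Compactness of \<open>A \<inter> S\<close> provides
  nearest points, so moving a sample into \<open>A\<close> costs exactly its distance. The knapsack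
  then supplies both an attaining distribution and a \<open>lam\<close> for which weak duality is
  tight.\<close>

lemma wasserstein_ball_sup:
  fixes nn :: "'a::euclidean_space \<Rightarrow> real"
  assumes nn: "is_norm nn" and N: "N \<ge> 1" and \<epsilon>: "0 < \<epsilon>" and A: "closed A" and S: "compact S"
    and \<xi>h: "\<And>i. i \<in> {1..N} \<Longrightarrow> \<xi>h i \<in> S" and ne: "A \<inter> S \<noteq> {}"
  obtains lam where "0 \<le> lam"
    "(SUP Q \<in> wasserstein_ball nn S \<epsilon> (empirical N \<xi>h). ereal (measure Q A))
      = ereal (lam * \<epsilon> + (\<Sum>i=1..N. max 0 (1 - lam * norm_dist nn (\<xi>h i) (A \<inter> S))) / real N)"
proof -
  let ?D = "\<lambda>i. norm_dist nn (\<xi>h i) (A \<inter> S)"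
  let ?val = "\<lambda>lam. lam * \<epsilon> + (\<Sum>i=1..N. max 0 (1 - lam * ?D i)) / real N"
  have "compact (A \<inter> S)" using A S by (rule closed_Int_compact)
  then have "\<exists>b. b \<in> A \<inter> S \<and> nn (\<xi>h i - b) = ?D i" for i
    using norm_dist_attained[OF nn _ ne, of "\<xi>h i"] by metis
  then obtain a where a: "\<And>i. a i \<in> A \<inter> S" "\<And>i. nn (\<xi>h i - a i) = ?D i" by metis
  \<comment> \<open>The budget is \<open>N * \<epsilon>\<close> because each sample carries mass
    \<open>1 / N\<close>.\<close>
  obtain w lam where w: "\<And>i. 0 \<le> w i" "\<And>i. w i \<le> 1" and lam: "0 \<le> lam"
    and cost: "(\<Sum>i=1..N. w i * ?D i) \<le> real N * \<epsilon>"
    and eq: "lam * (real N * \<epsilon>) + (\<Sum>i=1..N. max 0 (1 - lam * ?D i)) = (\<Sum>i=1..N. w i)"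
    by (rule fractional_knapsack[of "{1..N}" ?D "real N * \<epsilon>"])
      (use norm_dist_nonneg[OF nn ne] \<epsilon> in auto)
  obtain Q where Q: "Q \<in> wasserstein_ball nn S \<epsilon> (empirical N \<xi>h)" "(\<Sum>i=1..N. w i) / real N \<le> measure Q A"
    using ex_wasserstein_ball_transport[of nn N A S \<xi>h a w \<epsilon>] nn N A \<xi>h a w cost S
    by (auto simp: compact_imp_closed)
  have "?val lam = (\<Sum>i=1..N. w i) / real N" using N eq by (simp add: field_simps)
  then have "?val lam \<le> measure Q A" using Q(2) by simp
  show ?thesis
  proof (rule that[OF lam], rule order.antisym)
    show "(SUP Q \<in> wasserstein_ball nn S \<epsilon> (empirical N \<xi>h). ereal (measure Q A)) \<le> ereal (?val lam)"
      by (rule SUP_least) (use wasserstein_ball_measure_le[OF nn N \<epsilon> lam A ne] in simp)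
    show "ereal (?val lam) \<le> (SUP Q \<in> wasserstein_ball nn S \<epsilon> (empirical N \<xi>h). ereal (measure Q A))"
      by (rule SUP_upper2[OF Q(1)]) (use \<open>?val lam \<le> measure Q A\<close> in simp)
  qed
qed

section \<open>Multipliers as distance certificates\<close>

lemma uncertainty_set_iff: "\<xi> \<in> uncertainty_set V \<longleftrightarrow> (\<forall>l. V $ l \<bullet> \<xi> \<le> 1)"
  by (simp add: uncertainty_set_def less_eq_vec_def matrix_vector_mul_component)

lemma not_safe_open_iff:
  "\<xi> \<notin> safe_open V \<alpha> v \<longleftrightarrow> (\<exists>l. safety_bound V \<alpha> v $ l \<le> V $ l \<bullet> \<xi>)"
  by (auto simp: safe_open_def matrix_vector_mul_component not_less)

lemma safe_closed_iff:
  "\<xi> \<in> safe_closed V \<alpha> v \<longleftrightarrow> (\<forall>l. V $ l \<bullet> \<xi> \<le> safety_bound V \<alpha> v $ l)"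
  by (simp add: safe_closed_def less_eq_vec_def matrix_vector_mul_component)

lemma closed_Compl_safe_open: "closed {\<xi>. \<xi> \<notin> safe_open V \<alpha> v}"
proof -
  have "{\<xi>. \<xi> \<notin> safe_open V \<alpha> v} = (\<Union>l. {\<xi>. safety_bound V \<alpha> v $ l \<le> V $ l \<bullet> \<xi>})"
    by (auto simp: not_safe_open_iff)
  then show ?thesis by (auto intro!: closed_Union closed_halfspace_ge)
qed

lemma closed_safe_closed: "closed (safe_closed V \<alpha> v)"
proof -
  have "safe_closed V \<alpha> v = (\<Inter>l. {\<xi>. V $ l \<bullet> \<xi> \<le> safety_bound V \<alpha> v $ l})"
    by (auto simp: safe_closed_iff)
  then show ?thesis by (auto intro!: closed_INT closed_halfspace_le)
qed

text \<open>Identifies the combinations of rows produced by Farkas' lemma with the products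
  \<open>transpose V *v y\<close> in the multiplier constraints.\<close>

lemma vector_matrix_mult_eq_sum: "y v* V = (\<Sum>l\<in>UNIV. y $ l *\<^sub>R (V $ l :: real ^ 'n))"
  by (simp add: vec_eq_iff vector_matrix_mult_def mult.commute)

lemma inner_mono_nonneg:
  fixes y a b :: "real ^ 'l"
  assumes "0 \<le> y" "a \<le> b"
  shows "y \<bullet> a \<le> y \<bullet> b"
  using assms by (auto simp: inner_vec_def less_eq_vec_def intro!: sum_mono mult_left_mono)

text \<open>Every unsafe point \<open>a\<close> lies in some half-space \<open>l\<close>, and the
  certificate for that \<open>l\<close> bounds \<open>1 - s i\<close> by \<open>lam\<close> times
  the distance from the sample to \<open>a\<close>. Taking the infimum over \<open>a\<close> bounds
  \<open>s i\<close> from below.\<close>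

lemma worst_case_multipliers_le:
  assumes nn: "is_norm nn" and N: "N \<ge> 1"
    and m: "worst_case_multipliers nn V N \<xi>h \<alpha> v lam s \<gamma> \<theta>"
    and ne: "{\<xi>. \<xi> \<notin> safe_open V \<alpha> v} \<inter> uncertainty_set V \<noteq> {}" (is "?A \<inter> ?S \<noteq> {}")
  shows "0 \<le> lam"
    "\<And>i. i \<in> {1..N} \<Longrightarrow> max 0 (1 - lam * norm_dist nn (\<xi>h i) (?A \<inter> ?S)) \<le> s i"
proof -
  \<comment> \<open>The sign of \<open>lam\<close> is not among the constraints. It is read off from
    any one dual norm bound, here for sample 1 and an arbitrary row.\<close>
  have "dual_norm nn (\<theta> 1 undefined *\<^sub>R (V $ undefined) - transpose V *v \<gamma> 1 undefined) \<le> lam"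
    using m N by (auto simp: worst_case_multipliers_def)
  then show lam: "0 \<le> lam" using dual_norm_nonneg[OF nn] order_trans by blast
  fix i assume i: "i \<in> {1..N}"
  have s: "0 \<le> s i" using m i by (auto simp: worst_case_multipliers_def)
  have key: "1 - s i \<le> lam * nn (\<xi>h i - a)" if a: "a \<in> ?A \<inter> ?S" for a
  proof -
    obtain l where l: "safety_bound V \<alpha> v $ l \<le> V $ l \<bullet> a" using a by (auto simp: not_safe_open_iff)
    define c where "c = \<theta> i l *\<^sub>R (V $ l) - transpose V *v \<gamma> i l"
    have g: "0 \<le> \<gamma> i l" "0 \<le> \<theta> i l" "dual_norm nn c \<le> lam"
      and le: "1 - \<theta> i l * (safety_bound V \<alpha> v $ l - (V $ l) \<bullet> \<xi>h i) + \<gamma> i l \<bullet> (1 - V *v \<xi>h i) \<le> s i"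
      using m i by (auto simp: worst_case_multipliers_def c_def)
    have "\<gamma> i l \<bullet> (V *v a) \<le> \<gamma> i l \<bullet> 1"
      using a g(1) by (intro inner_mono_nonneg) (auto simp: uncertainty_set_def)
    moreover have "\<theta> i l * safety_bound V \<alpha> v $ l \<le> \<theta> i l * (V $ l \<bullet> a)"
      using l g(2) by (rule mult_left_mono)
    moreover have "c \<bullet> (a - \<xi>h i) \<le> lam * nn (a - \<xi>h i)"
      using inner_le_dual_norm[OF nn, of c "a - \<xi>h i"] mult_right_mono[OF g(3) is_norm_nonneg[OF nn, of "a - \<xi>h i"]]
      by linarith
    ultimately show ?thesis
      using le is_norm_diff_commute[OF nn, of a "\<xi>h i"]
      by (simp add: c_def inner_diff_left inner_diff_right dot_lmul_matrix algebra_simps)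
  qed
  have "1 - s i \<le> lam * norm_dist nn (\<xi>h i) (?A \<inter> ?S)"
    by (rule mult_norm_dist_greatest[OF lam ne]) (rule key)
  then show "max 0 (1 - lam * norm_dist nn (\<xi>h i) (?A \<inter> ?S)) \<le> s i" using s by simp
qed

text \<open>Polyhedral duality is applied to each half-space intersected with the polytope. The
  nonemptiness assumption for every \<open>l\<close> is what makes each of these certificates
  available.\<close>

lemma ex_worst_case_multipliers:
  assumes nn: "is_norm nn" and lam: "0 \<le> lam"
    and ne: "\<And>l. {\<xi>. (V $ l) \<bullet> \<xi> \<ge> safety_bound V \<alpha> v $ l} \<inter> uncertainty_set V \<noteq> {}"
  shows "\<exists>\<gamma> \<theta>. worst_case_multipliers nn V N \<xi>h \<alpha> v lam
    (\<lambda>i. max 0 (1 - lam * norm_dist nn (\<xi>h i) ({\<xi>. \<xi> \<notin> safe_open V \<alpha> v} \<inter> uncertainty_set V))) \<gamma> \<theta>"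
proof -
  let ?K = "{\<xi>. \<xi> \<notin> safe_open V \<alpha> v} \<inter> uncertainty_set V"
  have "\<exists>\<gamma> \<theta>. 0 \<le> \<gamma> \<and> 0 \<le> \<theta> \<and> dual_norm nn (\<theta> *\<^sub>R (V $ l) - transpose V *v \<gamma>) \<le> lam \<and>
      1 - \<theta> * (safety_bound V \<alpha> v $ l - (V $ l) \<bullet> z) + \<gamma> \<bullet> (1 - V *v z)
        \<le> 1 - lam * norm_dist nn z ?K" for l z
  proof -
    \<comment> \<open>The index \<open>None\<close> carries the half-space of \<open>l\<close>, the indices \<open>Some k\<close> the constraints of the polytope.\<close>
    define g where "g = case_option (- (V $ l)) (\<lambda>k. V $ k)"
    define h :: "'b option \<Rightarrow> real" where "h = case_option (- (safety_bound V \<alpha> v $ l)) (\<lambda>k. 1)"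
    have P: "{x. \<forall>j. g j \<bullet> x \<le> h j} = {\<xi>. (V $ l) \<bullet> \<xi> \<ge> safety_bound V \<alpha> v $ l} \<inter> uncertainty_set V"
      by (auto simp: g_def h_def uncertainty_set_iff split: option.splits)
    have sub: "{x. \<forall>j. g j \<bullet> x \<le> h j} \<subseteq> ?K" unfolding P by (auto simp: not_safe_open_iff)
    have Pne: "{x. \<forall>j. g j \<bullet> x \<le> h j} \<noteq> {}" unfolding P by (rule ne)
    obtain y where y: "\<And>j. 0 \<le> y j" "dual_norm nn (\<Sum>j\<in>UNIV. y j *\<^sub>R g j) \<le> lam"
      "lam * norm_dist nn z {x. \<forall>j. g j \<bullet> x \<le> h j} \<le> (\<Sum>j\<in>UNIV. y j * (g j \<bullet> z - h j))"
      using norm_dist_polyhedron_dual[OF nn Pne lam, of z] by blast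
    define \<gamma> :: "real ^ 'b" where "\<gamma> = (\<chi> k. y (Some k))"
    have inner_\<gamma>: "\<gamma> \<bullet> x = (\<Sum>k\<in>UNIV. y (Some k) * x $ k)" for x
      by (simp add: \<gamma>_def inner_vec_def)
    have split: "(\<Sum>j\<in>UNIV. f j) = f None + (\<Sum>k\<in>UNIV. f (Some k))" for f :: "'b option \<Rightarrow> 'c::comm_monoid_add"
      unfolding UNIV_option_conv by (simp add: sum.reindex)
    \<comment> \<open>The half-space is a lower bound on \<open>V $ l\<close>, so its normal enters
      negated, and the dual norm is invariant under the overall sign.\<close>
    have "(\<Sum>j\<in>UNIV. y j *\<^sub>R g j) = - (y None *\<^sub>R (V $ l) - transpose V *v \<gamma>)"
      unfolding split by (simp add: g_def \<gamma>_def vector_matrix_mult_eq_sum)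
    then have "dual_norm nn (y None *\<^sub>R (V $ l) - transpose V *v \<gamma>) \<le> lam"
      using y(2) dual_norm_minus[OF nn] by metis
    moreover have "(\<Sum>j\<in>UNIV. y j * (g j \<bullet> z - h j))
        = y None * (safety_bound V \<alpha> v $ l - (V $ l) \<bullet> z) - \<gamma> \<bullet> (1 - V *v z)"
      unfolding split
      by (simp add: g_def h_def inner_\<gamma> matrix_vector_mul_component right_diff_distrib sum_subtractf)
    \<comment> \<open>A single half-space meets the polytope in a subset of the unsafe part, so it
      is at least as far from \<open>z\<close>.\<close>
    moreover have "lam * norm_dist nn z ?K \<le> lam * norm_dist nn z {x. \<forall>j. g j \<bullet> x \<le> h j}"
      by (rule mult_left_mono[OF norm_dist_antimono[OF nn sub Pne] lam])
    ultimately show ?thesis using y(1,3)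
      by (intro exI[of _ \<gamma>] exI[of _ "y None"]) (auto simp: \<gamma>_def less_eq_vec_def)
  qed
  then obtain \<gamma> \<theta> where "\<And>l z. 0 \<le> \<gamma> l z \<and> 0 \<le> \<theta> l z \<and>
      dual_norm nn (\<theta> l z *\<^sub>R (V $ l) - transpose V *v \<gamma> l z) \<le> lam \<and>
      1 - \<theta> l z * (safety_bound V \<alpha> v $ l - (V $ l) \<bullet> z) + \<gamma> l z \<bullet> (1 - V *v z)
        \<le> 1 - lam * norm_dist nn z ?K"
    by metis
  then show ?thesis
    by (intro exI[of _ "\<lambda>i l. \<gamma> l (\<xi>h i)"] exI[of _ "\<lambda>i l. \<theta> l (\<xi>h i)"])
      (auto simp: worst_case_multipliers_def le_max_iff_disj)
qed

text \<open>The event is now an intersection of half-spaces, so a point of it satisfies all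
  constraints at once and the single certificate of sample \<open>i\<close> applies to every such
  point.\<close>

lemma best_case_multipliers_le:
  assumes nn: "is_norm nn" and N: "N \<ge> 1"
    and m: "best_case_multipliers nn V N \<xi>h \<alpha> v lam s \<gamma> \<theta>"
    and ne: "safe_closed V \<alpha> v \<inter> uncertainty_set V \<noteq> {}" (is "?A \<inter> ?S \<noteq> {}")
  shows "0 \<le> lam"
    "\<And>i. i \<in> {1..N} \<Longrightarrow> max 0 (1 - lam * norm_dist nn (\<xi>h i) (?A \<inter> ?S)) \<le> s i"
proof -
  have "dual_norm nn (transpose V *v \<theta> 1 + transpose V *v \<gamma> 1) \<le> lam"
    using m N by (auto simp: best_case_multipliers_def)
  then show lam: "0 \<le> lam" using dual_norm_nonneg[OF nn] order_trans by blast
  fix i assume i: "i \<in> {1..N}"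
  have s: "0 \<le> s i" using m i by (auto simp: best_case_multipliers_def)
  have key: "1 - s i \<le> lam * nn (\<xi>h i - a)" if a: "a \<in> ?A \<inter> ?S" for a
  proof -
    define c where "c = transpose V *v \<theta> i + transpose V *v \<gamma> i"
    have g: "0 \<le> \<gamma> i" "0 \<le> \<theta> i" "dual_norm nn c \<le> lam"
      and le: "1 + \<theta> i \<bullet> (safety_bound V \<alpha> v - V *v \<xi>h i) + \<gamma> i \<bullet> (1 - V *v \<xi>h i) \<le> s i"
      using m i by (auto simp: best_case_multipliers_def c_def)
    have "\<gamma> i \<bullet> (V *v a) \<le> \<gamma> i \<bullet> 1"
      using a g(1) by (intro inner_mono_nonneg) (auto simp: uncertainty_set_def)
    moreover have "\<theta> i \<bullet> (V *v a) \<le> \<theta> i \<bullet> safety_bound V \<alpha> v"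
      using a g(2) by (intro inner_mono_nonneg) (auto simp: safe_closed_def)
    moreover have "c \<bullet> (\<xi>h i - a) \<le> lam * nn (\<xi>h i - a)"
      using inner_le_dual_norm[OF nn, of c "\<xi>h i - a"] mult_right_mono[OF g(3) is_norm_nonneg[OF nn, of "\<xi>h i - a"]]
      by linarith
    ultimately show ?thesis
      using le by (simp add: c_def inner_add_left inner_diff_right dot_lmul_matrix)
  qed
  have "1 - s i \<le> lam * norm_dist nn (\<xi>h i) (?A \<inter> ?S)"
    by (rule mult_norm_dist_greatest[OF lam ne]) (rule key)
  then show "max 0 (1 - lam * norm_dist nn (\<xi>h i) (?A \<inter> ?S)) \<le> s i" using s by simp
qed

text \<open>The safe part of the polytope is itself a polyhedron, so polyhedral duality applies to
  it directly with one certificate per sample.\<close>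

lemma ex_best_case_multipliers:
  assumes nn: "is_norm nn" and lam: "0 \<le> lam"
    and ne: "safe_closed V \<alpha> v \<inter> uncertainty_set V \<noteq> {}"
  shows "\<exists>\<gamma> \<theta>. best_case_multipliers nn V N \<xi>h \<alpha> v lam
    (\<lambda>i. max 0 (1 - lam * norm_dist nn (\<xi>h i) (safe_closed V \<alpha> v \<inter> uncertainty_set V))) \<gamma> \<theta>"
proof -
  let ?K = "safe_closed V \<alpha> v \<inter> uncertainty_set V"
  have "\<exists>\<gamma> \<theta>. 0 \<le> \<gamma> \<and> 0 \<le> \<theta> \<and> dual_norm nn (transpose V *v \<theta> + transpose V *v \<gamma>) \<le> lam \<and>
      1 + \<theta> \<bullet> (safety_bound V \<alpha> v - V *v z) + \<gamma> \<bullet> (1 - V *v z) \<le> 1 - lam * norm_dist nn z ?K" for z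
  proof -
    \<comment> \<open>Both constraint systems have the rows of \<open>V\<close> as normals and
      differ only in the bounds. \<open>Inl\<close> indexes the safety bounds, whose multipliers
      become \<open>\<theta>\<close>, and \<open>Inr\<close> the polytope, whose multipliers become
      \<open>\<gamma>\<close>.\<close>
    define g where "g = case_sum (\<lambda>k. V $ k) (\<lambda>k. V $ k)"
    define h where "h = case_sum (\<lambda>k. safety_bound V \<alpha> v $ k) (\<lambda>k::'b. 1)"
    have P: "{x. \<forall>j. g j \<bullet> x \<le> h j} = ?K"
      by (auto simp: g_def h_def uncertainty_set_iff safe_closed_iff split: sum.splits)
    obtain y where y: "\<And>j. 0 \<le> y j" "dual_norm nn (\<Sum>j\<in>UNIV. y j *\<^sub>R g j) \<le> lam"
      "lam * norm_dist nn z ?K \<le> (\<Sum>j\<in>UNIV. y j * (g j \<bullet> z - h j))"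
      using norm_dist_polyhedron_dual[OF nn _ lam, of g h z] ne unfolding P by blast
    define \<theta> :: "real ^ 'b" where "\<theta> = (\<chi> k. y (Inl k))"
    define \<gamma> :: "real ^ 'b" where "\<gamma> = (\<chi> k. y (Inr k))"
    have inner_\<theta>: "\<theta> \<bullet> x = (\<Sum>k\<in>UNIV. y (Inl k) * x $ k)"
      and inner_\<gamma>: "\<gamma> \<bullet> x = (\<Sum>k\<in>UNIV. y (Inr k) * x $ k)" for x
      by (simp_all add: \<theta>_def \<gamma>_def inner_vec_def)
    have split: "(\<Sum>j\<in>UNIV. f j) = (\<Sum>k\<in>UNIV. f (Inl k)) + (\<Sum>k\<in>UNIV. f (Inr k))"
      for f :: "'b + 'b \<Rightarrow> 'c::comm_monoid_add"
      using sum.Plus[of "UNIV :: 'b set" "UNIV :: 'b set" f] by (simp add: comp_def)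
    have "(\<Sum>j\<in>UNIV. y j *\<^sub>R g j) = transpose V *v \<theta> + transpose V *v \<gamma>"
      unfolding split by (simp add: g_def \<gamma>_def \<theta>_def vector_matrix_mult_eq_sum)
    moreover have "(\<Sum>j\<in>UNIV. y j * (g j \<bullet> z - h j))
        = - (\<theta> \<bullet> (safety_bound V \<alpha> v - V *v z)) - \<gamma> \<bullet> (1 - V *v z)"
      unfolding split
      by (simp add: g_def h_def inner_\<theta> inner_\<gamma> matrix_vector_mul_component right_diff_distrib sum_subtractf)
    ultimately show ?thesis using y
      by (intro exI[of _ \<gamma>] exI[of _ \<theta>]) (auto simp: \<gamma>_def \<theta>_def less_eq_vec_def)
  qed
  then obtain \<gamma> \<theta> where "\<And>z. 0 \<le> \<gamma> z \<and> 0 \<le> \<theta> z \<and>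
      dual_norm nn (transpose V *v \<theta> z + transpose V *v \<gamma> z) \<le> lam \<and>
      1 + \<theta> z \<bullet> (safety_bound V \<alpha> v - V *v z) + \<gamma> z \<bullet> (1 - V *v z) \<le> 1 - lam * norm_dist nn z ?K"
    by metis
  then show ?thesis
    by (intro exI[of _ "\<lambda>i. \<gamma> (\<xi>h i)"] exI[of _ "\<lambda>i. \<theta> (\<xi>h i)"])
      (auto simp: best_case_multipliers_def le_max_iff_disj)
qed

section \<open>Equality of the optimal values\<close>

theorem proposition1:
  fixes nn :: "real ^ 'n \<Rightarrow> real"
    and V :: "real ^ 'n ^ 'l"
    and N :: nat
    and \<xi>h :: "nat \<Rightarrow> real ^ 'n"
    and \<epsilon> :: real
    and X :: "(real ^ 'p) set"
    and f :: "real ^ 'p \<Rightarrow> real ^ 'n \<Rightarrow> real ^ 'q"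
  assumes "is_norm nn"
    and "polytope (uncertainty_set V)"
    and "N \<ge> 1"
    and "\<forall>i\<in>{1..N}. \<xi>h i \<in> uncertainty_set V"
    and "\<epsilon> > 0"
  shows "((\<forall>\<alpha>\<in>{0..1}. \<forall>v\<in>uncertainty_set V. \<forall>l.
        {\<xi>. (V $ l) \<bullet> \<xi> \<ge> safety_bound V \<alpha> v $ l} \<inter> uncertainty_set V \<noteq> {}) \<longrightarrow>
     (INF (x, \<alpha>, v) \<in> {(x, \<alpha>, v). x \<in> X \<and> \<alpha> \<in> {0..1} \<and> v \<in> uncertainty_set V \<and>
                              (\<forall>\<xi>\<in>safe_open V \<alpha> v. f x \<xi> \<le> 0)}.
        SUP Q \<in> wasserstein_ball nn (uncertainty_set V) \<epsilon> (empirical N \<xi>h).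
          ereal (measure Q {\<xi>. \<xi> \<notin> safe_open V \<alpha> v})) =
     Inf {ereal (lam * \<epsilon> + (\<Sum>i=1..N. s i) / real N) | \<alpha> x v lam s \<gamma> \<theta>.
            worst_case_multipliers nn V N \<xi>h \<alpha> v lam s \<gamma> \<theta> \<and>
            0 \<le> \<alpha> \<and> \<alpha> \<le> 1 \<and> V *v v \<le> 1 \<and>
            x \<in> X \<and> (\<forall>\<xi>\<in>safe_open V \<alpha> v. f x \<xi> \<le> 0)}) \<and>
    ((\<forall>\<alpha>\<in>{0..1}. \<forall>v\<in>uncertainty_set V. safe_closed V \<alpha> v \<inter> uncertainty_set V \<noteq> {}) \<longrightarrow>
     (SUP (x, \<alpha>, v) \<in> {(x, \<alpha>, v). x \<in> X \<and> \<alpha> \<in> {0..1} \<and> v \<in> uncertainty_set V \<and>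
                              (\<forall>\<xi>\<in>safe_closed V \<alpha> v. f x \<xi> \<le> 0)}.
        SUP Q \<in> wasserstein_ball nn (uncertainty_set V) \<epsilon> (empirical N \<xi>h).
          ereal (measure Q {\<xi>. \<xi> \<in> safe_closed V \<alpha> v})) =
     Sup {ereal z | z \<alpha> x v.
            (\<forall>lam s \<gamma> \<theta>. best_case_multipliers nn V N \<xi>h \<alpha> v lam s \<gamma> \<theta> \<longrightarrow>
               z \<le> lam * \<epsilon> + (\<Sum>i=1..N. s i) / real N) \<and>
            0 \<le> \<alpha> \<and> \<alpha> \<le> 1 \<and> V *v v \<le> 1 \<and>
            x \<in> X \<and> (\<forall>\<xi>\<in>safe_closed V \<alpha> v. f x \<xi> \<le> 0)})"
proof (intro conjI impI)
  let ?S = "uncertainty_set V"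
  let ?ball = "wasserstein_ball nn ?S \<epsilon> (empirical N \<xi>h)"
  note nn = assms(1) and N = assms(3) and \<epsilon> = assms(5)
  have S: "compact ?S" using assms(2) by (rule polytope_imp_compact)
  have \<xi>h: "\<xi>h i \<in> ?S" if "i \<in> {1..N}" for i using assms(4) that by blast
  \<comment> \<open>The dual objective at \<open>lam\<close> with every \<open>s i\<close> at its
    smallest value allowed by the distance certificates.\<close>
  let ?val = "\<lambda>K lam. lam * \<epsilon> + (\<Sum>i=1..N. max 0 (1 - lam * norm_dist nn (\<xi>h i) K)) / real N"
  have sup_le: "(SUP Q\<in>?ball. ereal (measure Q A)) \<le> ereal (?val (A \<inter> ?S) lam)"
    if "closed A" "A \<inter> ?S \<noteq> {}" "0 \<le> lam" for A lam
    by (rule SUP_least) (use wasserstein_ball_measure_le[OF nn N \<epsilon> that(3,1,2)] in simp)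
  have val_le: "?val K lam \<le> lam * \<epsilon> + (\<Sum>i=1..N. s i) / real N"
    if "\<And>i. i \<in> {1..N} \<Longrightarrow> max 0 (1 - lam * norm_dist nn (\<xi>h i) K) \<le> s i" for K lam s
    by (intro add_left_mono divide_right_mono sum_mono that) auto
  {
    assume hyp: "\<forall>\<alpha>\<in>{0..1}. \<forall>v\<in>?S. \<forall>l. {\<xi>. (V $ l) \<bullet> \<xi> \<ge> safety_bound V \<alpha> v $ l} \<inter> ?S \<noteq> {}"
    let ?A = "\<lambda>\<alpha> v. {\<xi>. \<xi> \<notin> safe_open V \<alpha> v}"
    let ?F = "{(x, \<alpha>, v). x \<in> X \<and> \<alpha> \<in> {0..1} \<and> v \<in> ?S \<and> (\<forall>\<xi>\<in>safe_open V \<alpha> v. f x \<xi> \<le> 0)}"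
    let ?R = "{ereal (lam * \<epsilon> + (\<Sum>i=1..N. s i) / real N) | \<alpha> x v lam s \<gamma> \<theta>.
            worst_case_multipliers nn V N \<xi>h \<alpha> v lam s \<gamma> \<theta> \<and>
            0 \<le> \<alpha> \<and> \<alpha> \<le> 1 \<and> V *v v \<le> 1 \<and>
            x \<in> X \<and> (\<forall>\<xi>\<in>safe_open V \<alpha> v. f x \<xi> \<le> 0)}"
    have ne: "?A \<alpha> v \<inter> ?S \<noteq> {}" if "\<alpha> \<in> {0..1}" "v \<in> ?S" for \<alpha> v
      using hyp that not_safe_open_iff by fast
    show "(INF (x, \<alpha>, v)\<in>?F. SUP Q\<in>?ball. ereal (measure Q (?A \<alpha> v))) = Inf ?R"
    proof (rule order.antisym)
      \<comment> \<open>Any feasible multipliers give an upper bound on the worst-case probability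
        at the same \<open>(x, \<alpha>, v)\<close>.\<close>
      show "(INF (x, \<alpha>, v)\<in>?F. SUP Q\<in>?ball. ereal (measure Q (?A \<alpha> v))) \<le> Inf ?R"
      proof (rule Inf_greatest)
        fix r assume "r \<in> ?R"
        then obtain \<alpha> x v lam s \<gamma> \<theta> where r: "r = ereal (lam * \<epsilon> + (\<Sum>i=1..N. s i) / real N)"
          and m: "worst_case_multipliers nn V N \<xi>h \<alpha> v lam s \<gamma> \<theta>" and F: "(x, \<alpha>, v) \<in> ?F"
          by (auto simp: uncertainty_set_def)
        then have ne': "?A \<alpha> v \<inter> ?S \<noteq> {}" by (intro ne) auto
        note le = worst_case_multipliers_le[OF nn N m ne']
        have "(INF (x, \<alpha>, v)\<in>?F. SUP Q\<in>?ball. ereal (measure Q (?A \<alpha> v)))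
            \<le> (SUP Q\<in>?ball. ereal (measure Q (?A \<alpha> v)))"
          using INF_lower[OF F, of "\<lambda>(x, \<alpha>, v). SUP Q\<in>?ball. ereal (measure Q (?A \<alpha> v))"] by simp
        also have "\<dots> \<le> ereal (?val (?A \<alpha> v \<inter> ?S) lam)"
          by (rule sup_le[OF closed_Compl_safe_open ne' le(1)])
        also have "\<dots> \<le> r" unfolding r using val_le[OF le(2)] by simp
        finally show "(INF (x, \<alpha>, v)\<in>?F. SUP Q\<in>?ball. ereal (measure Q (?A \<alpha> v))) \<le> r" .
      qed
      \<comment> \<open>Conversely, the \<open>lam\<close> at which weak duality is tight has
        multipliers, so the worst-case probability itself is an objective value of the
        program.\<close>
      show "Inf ?R \<le> (INF (x, \<alpha>, v)\<in>?F. SUP Q\<in>?ball. ereal (measure Q (?A \<alpha> v)))"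
      proof (rule INF_greatest, clarify)
        fix x \<alpha> v assume F: "x \<in> X" "\<alpha> \<in> {0..1}" "v \<in> ?S" "\<forall>\<xi>\<in>safe_open V \<alpha> v. f x \<xi> \<le> 0"
        obtain lam where lam: "0 \<le> lam"
          "(SUP Q\<in>?ball. ereal (measure Q (?A \<alpha> v))) = ereal (?val (?A \<alpha> v \<inter> ?S) lam)"
          by (rule wasserstein_ball_sup[OF nn N \<epsilon> closed_Compl_safe_open S \<xi>h ne[OF F(2,3)]]) auto
        obtain \<gamma> \<theta> where "worst_case_multipliers nn V N \<xi>h \<alpha> v lam
            (\<lambda>i. max 0 (1 - lam * norm_dist nn (\<xi>h i) (?A \<alpha> v \<inter> ?S))) \<gamma> \<theta>"
          using ex_worst_case_multipliers[OF nn lam(1), of V \<alpha> v N \<xi>h] hyp F by blast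
        moreover have "0 \<le> \<alpha>" "\<alpha> \<le> 1" "V *v v \<le> 1" using F by (auto simp: uncertainty_set_def)
        ultimately have "ereal (?val (?A \<alpha> v \<inter> ?S) lam) \<in> ?R"
          using F(1,4) by (intro CollectI exI conjI) (rule refl, assumption+)
        then show "Inf ?R \<le> (SUP Q\<in>?ball. ereal (measure Q (?A \<alpha> v)))"
          unfolding lam(2) by (rule Inf_lower)
      qed
    qed
  }
  {
    assume hyp: "\<forall>\<alpha>\<in>{0..1}. \<forall>v\<in>?S. safe_closed V \<alpha> v \<inter> ?S \<noteq> {}"
    let ?A = "\<lambda>\<alpha> v. {\<xi>. \<xi> \<in> safe_closed V \<alpha> v}"
    let ?F = "{(x, \<alpha>, v). x \<in> X \<and> \<alpha> \<in> {0..1} \<and> v \<in> ?S \<and> (\<forall>\<xi>\<in>safe_closed V \<alpha> v. f x \<xi> \<le> 0)}"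
    let ?dual = "\<lambda>z \<alpha> v. \<forall>lam s \<gamma> \<theta>. best_case_multipliers nn V N \<xi>h \<alpha> v lam s \<gamma> \<theta> \<longrightarrow>
               z \<le> lam * \<epsilon> + (\<Sum>i=1..N. s i) / real N"
    let ?R = "{ereal z | z \<alpha> x v. ?dual z \<alpha> v \<and>
            0 \<le> \<alpha> \<and> \<alpha> \<le> 1 \<and> V *v v \<le> 1 \<and>
            x \<in> X \<and> (\<forall>\<xi>\<in>safe_closed V \<alpha> v. f x \<xi> \<le> 0)}"
    have sup: "\<exists>lam\<ge>0. (SUP Q\<in>?ball. ereal (measure Q (?A \<alpha> v))) = ereal (?val (?A \<alpha> v \<inter> ?S) lam)"
      if "\<alpha> \<in> {0..1}" "v \<in> ?S" for \<alpha> v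
      by (rule wasserstein_ball_sup[OF nn N \<epsilon> _ S \<xi>h, of "?A \<alpha> v"])
        (use hyp that closed_safe_closed in auto)
    show "(SUP (x, \<alpha>, v)\<in>?F. SUP Q\<in>?ball. ereal (measure Q (?A \<alpha> v))) = Sup ?R"
    proof (rule order.antisym)
      show "(SUP (x, \<alpha>, v)\<in>?F. SUP Q\<in>?ball. ereal (measure Q (?A \<alpha> v))) \<le> Sup ?R"
      proof (rule SUP_least, clarify)
        fix x \<alpha> v assume F: "x \<in> X" "\<alpha> \<in> {0..1}" "v \<in> ?S" "\<forall>\<xi>\<in>safe_closed V \<alpha> v. f x \<xi> \<le> 0"
        have ne: "safe_closed V \<alpha> v \<inter> ?S \<noteq> {}" using hyp F by blast
        obtain lam where lam: "0 \<le> lam"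
          "(SUP Q\<in>?ball. ereal (measure Q (?A \<alpha> v))) = ereal (?val (?A \<alpha> v \<inter> ?S) lam)"
          using sup[OF F(2,3)] by blast
        \<comment> \<open>The best-case probability lies below the dual objective of all admissible
          multipliers, so it is an admissible \<open>z\<close>.\<close>
        have "?dual (?val (?A \<alpha> v \<inter> ?S) lam) \<alpha> v"
        proof (intro allI impI)
          fix lam' s \<gamma> \<theta> assume m: "best_case_multipliers nn V N \<xi>h \<alpha> v lam' s \<gamma> \<theta>"
          note le = best_case_multipliers_le[OF nn N m ne]
          have "ereal (?val (?A \<alpha> v \<inter> ?S) lam) \<le> ereal (?val (?A \<alpha> v \<inter> ?S) lam')"
            unfolding lam(2)[symmetric] using sup_le[OF closed_safe_closed ne le(1)] by simp
          also have "\<dots> \<le> ereal (lam' * \<epsilon> + (\<Sum>i=1..N. s i) / real N)"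
            using val_le[OF le(2)] by simp
          finally show "?val (?A \<alpha> v \<inter> ?S) lam \<le> lam' * \<epsilon> + (\<Sum>i=1..N. s i) / real N" by simp
        qed
        moreover have "0 \<le> \<alpha>" "\<alpha> \<le> 1" "V *v v \<le> 1" using F by (auto simp: uncertainty_set_def)
        ultimately have "ereal (?val (?A \<alpha> v \<inter> ?S) lam) \<in> ?R"
          using F(1,4) by (intro CollectI exI conjI) (rule refl, assumption+)
        then show "(SUP Q\<in>?ball. ereal (measure Q (?A \<alpha> v))) \<le> Sup ?R"
          unfolding lam(2) by (rule Sup_upper)
      qed
      show "Sup ?R \<le> (SUP (x, \<alpha>, v)\<in>?F. SUP Q\<in>?ball. ereal (measure Q (?A \<alpha> v)))"
      proof (rule Sup_least)
        fix r assume "r \<in> ?R"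
        then obtain z \<alpha> x v where r: "r = ereal z" and dual: "?dual z \<alpha> v" and F: "(x, \<alpha>, v) \<in> ?F"
          by (auto simp: uncertainty_set_def)
        then have "\<alpha> \<in> {0..1}" "v \<in> ?S" and ne: "safe_closed V \<alpha> v \<inter> ?S \<noteq> {}" using hyp by auto
        then obtain lam where lam: "0 \<le> lam"
          "(SUP Q\<in>?ball. ereal (measure Q (?A \<alpha> v))) = ereal (?val (?A \<alpha> v \<inter> ?S) lam)"
          using sup by blast
        \<comment> \<open>Since \<open>z\<close> bounds the objective for all multipliers, it can be
          tested against those existing at the tight \<open>lam\<close>, where the objective is the
          best-case probability.\<close>
        have "r \<le> ereal (?val (?A \<alpha> v \<inter> ?S) lam)"
          using ex_best_case_multipliers[OF nn lam(1) ne, of N \<xi>h] dual by (auto simp: r)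
        also have "\<dots> \<le> (SUP (x, \<alpha>, v)\<in>?F. SUP Q\<in>?ball. ereal (measure Q (?A \<alpha> v)))"
          using SUP_upper[OF F, of "\<lambda>(x, \<alpha>, v). SUP Q\<in>?ball. ereal (measure Q (?A \<alpha> v))"]
          unfolding lam(2)[symmetric] by simp
        finally show "r \<le> (SUP (x, \<alpha>, v)\<in>?F. SUP Q\<in>?ball. ereal (measure Q (?A \<alpha> v)))" .
      qed
    qed
  }
qed

end
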